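(* A finitely presented subquandle separable quandle has the solvable generalised word problem. That is, if $X$ is a finitely presented quandle that is subquandle separable and $Y$ is a finitely generated subquandle of $X$, then there is an algorithm that decides, for an arbitrary element $w$ of $X$ (given as a quandle word in the generators of a finite presentation of $X$), whether or not $w$ lies in $Y$.
   Context: A quandle is a set $X$ with a binary operation $*$ such that: (1) $x*x=x$ for all $x$; (2) for all $x,y \in X$ there is a unique $z\in X$ with $x=z*y$ (written $z=x*^{-1}y$); (3) $(x*y)*z=(x*z)*(y*z)$ for all $x,y,z$. A quandle is finitely presented if it has a presentation $\langle S\mid R\rangle$, as a quandle, with finitely many generators and finitely many relations; quandle words in $S$ are formal expressions built from elements of $S$ using $*$ and $*^{-1}$. A subquandle is a subset closed under $*$ and $*^{-1}$; it is finitely generated if it is the smallest subquandle containing some finite set. A subset $S$ of a quandle $X$ is separable in $X$ if for each $x\in X\setminus S$ there exist a finite quandle $F$ and a quandle homomorphism $\phi:X\to F$ with $\phi(x)\notin\phi(S)$. A quandle is subquandle separable if each of its finitely generated subquandles is separable. *)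

theory Defs
  imports Main "HOL-Library.Nat_Bijection"
begin

section \<open>Quandles\<close>

locale quandle =
  fixes X :: "'a set" and op :: "'a \<Rightarrow> 'a \<Rightarrow> 'a"  (infixl "\<star>" 70)
  assumes closed: "x \<in> X \<Longrightarrow> y \<in> X \<Longrightarrow> x \<star> y \<in> X"
    and idem: "x \<in> X \<Longrightarrow> x \<star> x = x"
    and right_div: "x \<in> X \<Longrightarrow> y \<in> X \<Longrightarrow> \<exists>!z. z \<in> X \<and> x = z \<star> y"
    and distrib: "x \<in> X \<Longrightarrow> y \<in> X \<Longrightarrow> z \<in> X \<Longrightarrow> (x \<star> y) \<star> z = (x \<star> z) \<star> (y \<star> z)"

definition qdiv :: "'a set \<Rightarrow> ('a \<Rightarrow> 'a \<Rightarrow> 'a) \<Rightarrow> 'a \<Rightarrow> 'a \<Rightarrow> 'a" where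
  "qdiv X op x y = (THE z. z \<in> X \<and> x = op z y)"

definition quandle_hom ::
  "'a set \<Rightarrow> ('a \<Rightarrow> 'a \<Rightarrow> 'a) \<Rightarrow> 'b set \<Rightarrow> ('b \<Rightarrow> 'b \<Rightarrow> 'b) \<Rightarrow> ('a \<Rightarrow> 'b) \<Rightarrow> bool" where
  "quandle_hom X op F op' \<phi> \<longleftrightarrow>
     (\<forall>x\<in>X. \<phi> x \<in> F) \<and> (\<forall>x\<in>X. \<forall>y\<in>X. \<phi> (op x y) = op' (\<phi> x) (\<phi> y))"

definition subquandle :: "'a set \<Rightarrow> ('a \<Rightarrow> 'a \<Rightarrow> 'a) \<Rightarrow> 'a set \<Rightarrow> bool" where
  "subquandle X op Y \<longleftrightarrow>
     Y \<subseteq> X \<and> (\<forall>x\<in>Y. \<forall>y\<in>Y. op x y \<in> Y \<and> qdiv X op x y \<in> Y)"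

definition fin_gen_subquandle :: "'a set \<Rightarrow> ('a \<Rightarrow> 'a \<Rightarrow> 'a) \<Rightarrow> 'a set \<Rightarrow> bool" where
  "fin_gen_subquandle X op Y \<longleftrightarrow>
     (\<exists>A. finite A \<and> A \<subseteq> Y \<and> subquandle X op Y \<and>
          (\<forall>Z. subquandle X op Z \<and> A \<subseteq> Z \<longrightarrow> Y \<subseteq> Z))"

text \<open>The finite quandle in the definition of separability is taken with underlying set of
  natural numbers, since a definition cannot quantify over types. This is no restriction: see
  \<open>separable_iff\<close> below.\<close>

definition separable :: "'a set \<Rightarrow> ('a \<Rightarrow> 'a \<Rightarrow> 'a) \<Rightarrow> 'a set \<Rightarrow> bool" where
  "separable X op S \<longleftrightarrow>
     (\<forall>x \<in> X - S. \<exists>(F :: nat set) op' \<phi>.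
        finite F \<and> quandle F op' \<and> quandle_hom X op F op' \<phi> \<and> \<phi> x \<notin> \<phi> ` S)"

definition subquandle_separable :: "'a set \<Rightarrow> ('a \<Rightarrow> 'a \<Rightarrow> 'a) \<Rightarrow> bool" where
  "subquandle_separable X op \<longleftrightarrow> (\<forall>Y. fin_gen_subquandle X op Y \<longrightarrow> separable X op Y)"

lemma separating_quandle_transfer:
  fixes F :: "'b set"
  assumes inf: "infinite (UNIV :: 'c set)" and fin: "finite F" and F: "quandle F op'" and \<phi>: "quandle_hom X op F op' \<phi>"
    and S: "S \<subseteq> X" and x: "x \<in> X" "\<phi> x \<notin> \<phi> ` S"
  shows "\<exists>(G :: 'c set) op'' \<psi>.
    finite G \<and> quandle G op'' \<and> quandle_hom X op G op'' \<psi> \<and> \<psi> x \<notin> \<psi> ` S"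
proof -
  obtain B :: "'c set" where B: "finite B" "card B = card F"
    using infinite_arbitrarily_large[OF inf, of "card F"] by blast
  then obtain h where "bij_betw h F B"
    using finite_same_card_bij[OF fin] by metis
  then have h: "inj_on h F" by (rule bij_betw_imp_inj_on)
  define k where "k = inv_into F h"
  define m where "m = (\<lambda>a b. h (op' (k a) (k b)))"
  have kh: "k (h a) = a" if "a \<in> F" for a
    using that h by (simp add: k_def)
  interpret F: quandle F op' by (rule F)
  have "quandle (h ` F) m"
  proof
    fix a b assume "a \<in> h ` F" "b \<in> h ` F"
    then obtain u v where uv: "u \<in> F" "v \<in> F" "a = h u" "b = h v" by blast
    show "m a b \<in> h ` F" using uv by (simp add: m_def kh F.closed)
    obtain w where w: "w \<in> F" "u = op' w v"
      and uniq: "\<And>w'. w' \<in> F \<Longrightarrow> u = op' w' v \<Longrightarrow> w' = w"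
      using F.right_div[OF uv(1,2)] by blast
    show "\<exists>!z. z \<in> h ` F \<and> a = m z b"
    proof (rule ex1I[of _ "h w"])
      show "h w \<in> h ` F \<and> a = m (h w) b" using w uv by (simp add: m_def kh)
    next
      fix z assume "z \<in> h ` F \<and> a = m z b"
      then obtain w' where w': "w' \<in> F" "z = h w'" "h u = h (op' w' v)"
        using uv by (auto simp: m_def kh)
      then have "u = op' w' v"
        using inj_onD[OF h w'(3)] uv F.closed by simp
      then show "z = h w" using uniq w' by simp
    qed
  next
    fix a assume "a \<in> h ` F"
    then show "m a a = a" by (auto simp: m_def kh F.idem)
  next
    fix a b c assume "a \<in> h ` F" "b \<in> h ` F" "c \<in> h ` F"
    then obtain u v w where uvw: "u \<in> F" "v \<in> F" "w \<in> F" "a = h u" "b = h v" "c = h w"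
      by blast
    then show "m (m a b) c = m (m a c) (m b c)"
      using F.distrib[OF uvw(1-3)] by (simp add: m_def kh F.closed)
  qed
  moreover have "quandle_hom X op (h ` F) m (h \<circ> \<phi>)"
    using \<phi> by (simp add: quandle_hom_def m_def kh)
  moreover have "(h \<circ> \<phi>) x \<notin> (h \<circ> \<phi>) ` S"
  proof
    assume "(h \<circ> \<phi>) x \<in> (h \<circ> \<phi>) ` S"
    then obtain s where "s \<in> S" "h (\<phi> x) = h (\<phi> s)" by auto
    moreover have "\<phi> x \<in> F" "\<phi> s \<in> F"
      using \<phi> S x \<open>s \<in> S\<close> by (auto simp: quandle_hom_def)
    ultimately show False using h x by (auto dest: inj_onD)
  qed
  ultimately show ?thesis using fin by blast
qed

lemma separable_iff:
  assumes "infinite (UNIV :: 'b set)" "S \<subseteq> X"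
  shows "separable X op S \<longleftrightarrow>
     (\<forall>x \<in> X - S. \<exists>(F :: 'b set) op' \<phi>.
        finite F \<and> quandle F op' \<and> quandle_hom X op F op' \<phi> \<and> \<phi> x \<notin> \<phi> ` S)"
proof (intro iffI ballI)
  fix x assume "separable X op S" and x: "x \<in> X - S"
  then obtain F :: "nat set" and op' \<phi> where
    F: "finite F" "quandle F op'" "quandle_hom X op F op' \<phi>" "\<phi> x \<notin> \<phi> ` S"
    unfolding separable_def by blast
  show "\<exists>(F :: 'b set) op' \<phi>.
      finite F \<and> quandle F op' \<and> quandle_hom X op F op' \<phi> \<and> \<phi> x \<notin> \<phi> ` S"
    using x by (intro separating_quandle_transfer[OF assms(1) F(1-3) assms(2) _ F(4)]) simp
next
  assume R: "\<forall>x \<in> X - S. \<exists>(F :: 'b set) op' \<phi>.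
      finite F \<and> quandle F op' \<and> quandle_hom X op F op' \<phi> \<and> \<phi> x \<notin> \<phi> ` S"
  show "separable X op S"
    unfolding separable_def
  proof
    fix x assume x: "x \<in> X - S"
    then obtain F :: "'b set" and op' \<phi> where
      F: "finite F" "quandle F op'" "quandle_hom X op F op' \<phi>" "\<phi> x \<notin> \<phi> ` S"
      using R by blast
    show "\<exists>(F :: nat set) op' \<phi>.
        finite F \<and> quandle F op' \<and> quandle_hom X op F op' \<phi> \<and> \<phi> x \<notin> \<phi> ` S"
      using x by (intro separating_quandle_transfer[OF infinite_UNIV_nat F(1-3) assms(2) _ F(4)]) simp
  qed
qed


section \<open>Finite presentations\<close>

text \<open>Generating symbols are natural numbers, so that words can be given to an algorithm.\<close>

datatype qword = Gen nat | Star qword qword | Div qword qword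

primrec symbols :: "qword \<Rightarrow> nat set" where
  "symbols (Gen i) = {i}"
| "symbols (Star u v) = symbols u \<union> symbols v"
| "symbols (Div u v) = symbols u \<union> symbols v"

definition words :: "nat set \<Rightarrow> qword set" where
  "words S = {w. symbols w \<subseteq> S}"

primrec qeval :: "'a set \<Rightarrow> ('a \<Rightarrow> 'a \<Rightarrow> 'a) \<Rightarrow> (nat \<Rightarrow> 'a) \<Rightarrow> qword \<Rightarrow> 'a" where
  "qeval X op g (Gen i) = g i"
| "qeval X op g (Star u v) = op (qeval X op g u) (qeval X op g v)"
| "qeval X op g (Div u v) = qdiv X op (qeval X op g u) (qeval X op g v)"

text \<open>The congruence on words over \<open>S\<close> generated by the relations \<open>R\<close> and the quandle axioms.
  The quotient is the quandle \<open>\<langle>S | R\<rangle>\<close>. The rules \<open>star_div\<close> and \<open>div_star\<close> express the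
  second axiom (existence and uniqueness of right quotients) equationally.\<close>

inductive qcong :: "nat set \<Rightarrow> (qword \<times> qword) set \<Rightarrow> qword \<Rightarrow> qword \<Rightarrow> bool"
  for S R where
  rel: "(u, v) \<in> R \<Longrightarrow> qcong S R u v"
| refl: "u \<in> words S \<Longrightarrow> qcong S R u u"
| sym: "qcong S R u v \<Longrightarrow> qcong S R v u"
| trans: "qcong S R u v \<Longrightarrow> qcong S R v w \<Longrightarrow> qcong S R u w"
| cong_Star: "qcong S R u u' \<Longrightarrow> qcong S R v v' \<Longrightarrow> qcong S R (Star u v) (Star u' v')"
| cong_Div: "qcong S R u u' \<Longrightarrow> qcong S R v v' \<Longrightarrow> qcong S R (Div u v) (Div u' v')"
| idem: "u \<in> words S \<Longrightarrow> qcong S R (Star u u) u"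
| star_div: "u \<in> words S \<Longrightarrow> v \<in> words S \<Longrightarrow> qcong S R (Div (Star u v) v) u"
| div_star: "u \<in> words S \<Longrightarrow> v \<in> words S \<Longrightarrow> qcong S R (Star (Div u v) v) u"
| distrib: "u \<in> words S \<Longrightarrow> v \<in> words S \<Longrightarrow> w \<in> words S \<Longrightarrow>
    qcong S R (Star (Star u v) w) (Star (Star u w) (Star v w))"

text \<open>\<open>\<langle>S | R\<rangle>\<close> is a finite presentation of \<open>X\<close>, where \<open>g\<close> interprets the symbols in \<open>X\<close>:
  evaluation of words induces an isomorphism from the quotient of \<open>words S\<close> by \<open>qcong S R\<close>
  onto \<open>X\<close>.\<close>

definition finite_presentation ::
  "'a set \<Rightarrow> ('a \<Rightarrow> 'a \<Rightarrow> 'a) \<Rightarrow> nat set \<Rightarrow> (qword \<times> qword) set \<Rightarrow> (nat \<Rightarrow> 'a) \<Rightarrow> bool" where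
  "finite_presentation X op S R g \<longleftrightarrow>
     finite S \<and> finite R \<and> R \<subseteq> words S \<times> words S \<and>
     g ` S \<subseteq> X \<and> qeval X op g ` words S = X \<and>
     (\<forall>u\<in>words S. \<forall>v\<in>words S. qeval X op g u = qeval X op g v \<longleftrightarrow> qcong S R u v)"

definition finitely_presented :: "'a set \<Rightarrow> ('a \<Rightarrow> 'a \<Rightarrow> 'a) \<Rightarrow> bool" where
  "finitely_presented X op \<longleftrightarrow> (\<exists>S R g. finite_presentation X op S R g)"


section \<open>Algorithms\<close>

text \<open>\<open>recursive n f\<close>: the restriction of \<open>f\<close> to argument lists of length \<open>n\<close> is a (total)
  recursive function of \<open>n\<close> arguments. Minimisation is applied to regular functions only, so
  that no partial functions are needed; by Kleene's normal form theorem this still yields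
  every total computable function. Values on lists of any other length are irrelevant.\<close>

inductive recursive :: "nat \<Rightarrow> (nat list \<Rightarrow> nat) \<Rightarrow> bool" where
  zero: "recursive n (\<lambda>xs. 0)"
| succ: "recursive 1 (\<lambda>xs. Suc (xs ! 0))"
| proj: "i < n \<Longrightarrow> recursive n (\<lambda>xs. xs ! i)"
| comp: "recursive (length gs) f \<Longrightarrow> \<forall>g \<in> set gs. recursive n g \<Longrightarrow>
    recursive n (\<lambda>xs. f (map (\<lambda>g. g xs) gs))"
| prim_rec: "recursive n f \<Longrightarrow> recursive (Suc (Suc n)) h \<Longrightarrow>
    recursive (Suc n) (\<lambda>xs. rec_nat (f (tl xs)) (\<lambda>k r. h (k # r # tl xs)) (hd xs))"
| minim: "recursive (Suc n) f \<Longrightarrow> \<forall>xs. length xs = n \<longrightarrow> (\<exists>k. f (k # xs) = 0) \<Longrightarrow>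
    recursive n (\<lambda>xs. LEAST k. f (k # xs) = 0)"

primrec code :: "qword \<Rightarrow> nat" where
  "code (Gen i) = 3 * i"
| "code (Star u v) = 3 * prod_encode (code u, code v) + 1"
| "code (Div u v) = 3 * prod_encode (code u, code v) + 2"

definition algorithm_decides :: "qword set \<Rightarrow> (qword \<Rightarrow> bool) \<Rightarrow> bool" where
  "algorithm_decides W P \<longleftrightarrow>
     (\<exists>f. recursive 1 f \<and> (\<forall>w\<in>W. f [code w] = (if P w then 1 else 0)))"

definition solvable_generalised_word_problem ::
  "'a set \<Rightarrow> ('a \<Rightarrow> 'a \<Rightarrow> 'a) \<Rightarrow> bool" where
  "solvable_generalised_word_problem X op \<longleftrightarrow>
     (\<forall>S R g Y. finite_presentation X op S R g \<and> fin_gen_subquandle X op Y \<longrightarrow>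
        algorithm_decides (words S) (\<lambda>w. qeval X op g w \<in> Y))"

end

theory Submission
  imports Defs
begin

text \<open>
  Fix a finite presentation of \<open>X\<close> and a finitely generated subquandle \<open>Y\<close>, whose generators are
  represented by a finite set \<open>A\<close> of words. Membership in \<open>Y\<close> and non-membership in \<open>Y\<close> are both
  semidecidable, so running the two searches side by side decides membership.

  A word \<open>w\<close> lies in \<open>Y\<close> if and only if it is congruent to a word built from \<open>A\<close>, and the
  congruence of a finite presentation can be enumerated: apply the finitely many rules over and over
  to the finitely many facts found so far (\<open>ex_stage_iff\<close>).

  A word \<open>w\<close> lies outside \<open>Y\<close> if and only if some finite quandle shows this. By separability there is
  a homomorphism \<open>\<phi>\<close> from \<open>X\<close> to a finite quandle \<open>F\<close> with \<open>\<phi> w \<notin> \<phi> ` Y\<close>. By the universal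
  property of the presentation such homomorphisms are finite objects: an operation table for \<open>F\<close>
  and images of the generators that satisfy the relations. Whether such data show \<open>w \<notin> Y\<close> is checked
  in finite time, since it suffices to exhibit a closed subset of \<open>F\<close> that contains the images of
  \<open>A\<close> and avoids that of \<open>w\<close> (\<open>refutes_sound\<close>, \<open>refutes_complete\<close>).

  The remaining work is to see that these procedures are recursive functions. All finite objects are
  coded by numbers: tuples by pairing, finite sets by binary digits, finite functions by their graphs.
  Both checks are then built from bounded quantifiers, lookups and the evaluation of words. Evaluation
  recurses on words and is the one construct that is not immediate; it is obtained by searching for
  a table of all intermediate values (\<open>computable_fold_word\<close>). The final combination of the two
  searches is \<open>algorithm_decides_race\<close>.
\<close>


section \<open>Closure properties of recursive functions\<close>

text \<open>The clauses of \<open>recursive\<close> produce functions with particular values on argument lists of the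
  wrong length. Only agreement on lists of length \<open>n\<close> matters, and asking for no more lets a
  function be written as \<open>\<lambda>xs. xs ! 0 + xs ! 1\<close> instead of in the shape that a clause happens
  to produce.\<close>

definition recursive_on :: "nat \<Rightarrow> (nat list \<Rightarrow> nat) \<Rightarrow> bool" where
  "recursive_on n f \<longleftrightarrow> (\<exists>g. recursive n g \<and> (\<forall>xs. length xs = n \<longrightarrow> g xs = f xs))"

lemma recursive_onI: "recursive n f \<Longrightarrow> recursive_on n f"
  unfolding recursive_on_def by blast

lemma recursive_on_cong:
  assumes "recursive_on n f" "\<And>xs. length xs = n \<Longrightarrow> f xs = g xs"
  shows "recursive_on n g"
  using assms unfolding recursive_on_def by metis

lemma recursive_on_comp:
  assumes "recursive_on (length gs) f" and "\<forall>g \<in> set gs. recursive_on n g"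
  shows "recursive_on n (\<lambda>xs. f (map (\<lambda>g. g xs) gs))"
proof -
  obtain f' where f': "recursive (length gs) f'" "\<And>xs. length xs = length gs \<Longrightarrow> f' xs = f xs"
    using assms(1) unfolding recursive_on_def by blast
  obtain r where r: "\<forall>g \<in> set gs. recursive n (r g) \<and> (\<forall>xs. length xs = n \<longrightarrow> r g xs = g xs)"
    using assms(2) unfolding recursive_on_def by metis
  have "recursive n (\<lambda>xs. f' (map (\<lambda>g. g xs) (map r gs)))"
    using f'(1) r by (intro recursive.comp) auto
  moreover have "f' (map (\<lambda>g. g xs) (map r gs)) = f (map (\<lambda>g. g xs) gs)" if "length xs = n" for xs
  proof -
    have "map (\<lambda>g. g xs) (map r gs) = map (\<lambda>g. g xs) gs"
      using r that by simp
    then show ?thesis by (simp only: f'(2) length_map)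
  qed
  ultimately show ?thesis unfolding recursive_on_def by blast
qed

lemma recursive_on_comp1:
  assumes "recursive_on 1 (\<lambda>ys. f (ys ! 0))" "recursive_on n g"
  shows "recursive_on n (\<lambda>xs. f (g xs))"
  using recursive_on_comp[of "[g]" "\<lambda>ys. f (ys ! 0)" n] assms by simp

lemma recursive_on_comp2:
  assumes "recursive_on 2 (\<lambda>ys. f (ys ! 0) (ys ! 1))" "recursive_on n g" "recursive_on n h"
  shows "recursive_on n (\<lambda>xs. f (g xs) (h xs))"
  using recursive_on_comp[of "[g, h]" "\<lambda>ys. f (ys ! 0) (ys ! 1)" n] assms
  by (simp add: numeral_2_eq_2)

lemma recursive_on_proj: "i < n \<Longrightarrow> recursive_on n (\<lambda>xs. xs ! i)"
  by (intro recursive_onI recursive.proj)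

lemma recursive_on_Suc: "recursive_on n f \<Longrightarrow> recursive_on n (\<lambda>xs. Suc (f xs))"
  using recursive_on_comp1[of Suc] recursive_onI[OF recursive.succ] by blast

lemma recursive_on_const: "recursive_on n (\<lambda>xs. c)"
proof (induction c)
  case 0
  show ?case by (intro recursive_onI recursive.zero)
next
  case (Suc c)
  then show ?case by (rule recursive_on_Suc)
qed

lemma recursive_on_prim_rec:
  assumes "recursive_on n f" "recursive_on (Suc (Suc n)) h"
  shows "recursive_on (Suc n) (\<lambda>xs. rec_nat (f (tl xs)) (\<lambda>k r. h (k # r # tl xs)) (hd xs))"
proof -
  obtain f' h' where *: "recursive n f'" "recursive (Suc (Suc n)) h'"
    and f': "\<And>xs. length xs = n \<Longrightarrow> f' xs = f xs"
    and h': "\<And>xs. length xs = Suc (Suc n) \<Longrightarrow> h' xs = h xs"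
    using assms unfolding recursive_on_def by blast
  show ?thesis
    by (rule recursive_on_cong[OF recursive_onI[OF recursive.prim_rec[OF *]]])
      (simp add: f' h')
qed

lemma recursive_on_minim:
  assumes "recursive_on (Suc n) f" and ex: "\<And>xs. length xs = n \<Longrightarrow> \<exists>k. f (k # xs) = 0"
  shows "recursive_on n (\<lambda>xs. LEAST k. f (k # xs) = 0)"
proof -
  obtain f' where *: "recursive (Suc n) f'" and f': "\<And>xs. length xs = Suc n \<Longrightarrow> f' xs = f xs"
    using assms(1) unfolding recursive_on_def by blast
  show ?thesis
    by (rule recursive_on_cong[OF recursive_onI[OF recursive.minim[OF *]]])
      (simp_all add: f' ex)
qed

text \<open>Recursion on the first of two arguments, with the second as a parameter. Addition, predecessor,
  subtraction and triangular numbers have this form, up to a swap or a spare argument.\<close>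

lemma recursive_on_rec2:
  assumes "recursive_on 1 (\<lambda>ys. f (ys ! 0))" "recursive_on 3 (\<lambda>ys. h (ys ! 0) (ys ! 1) (ys ! 2))"
  shows "recursive_on 2 (\<lambda>xs. rec_nat (f (xs ! 1)) (\<lambda>k r. h k r (xs ! 1)) (xs ! 0))"
proof -
  have "recursive_on (Suc (Suc 1)) (\<lambda>ys. h (ys ! 0) (ys ! 1) (ys ! 2))"
    using assms(2) by (simp add: numeral_3_eq_3)
  from recursive_on_prim_rec[OF assms(1) this]
  have "recursive_on 2 (\<lambda>xs. rec_nat (f (tl xs ! 0)) (\<lambda>k r. h k r (tl xs ! 0)) (hd xs))"
    by (simp add: numeral_2_eq_2)
  then show ?thesis
    by (rule recursive_on_cong) (auto simp: numeral_2_eq_2 length_Suc_conv)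
qed

lemma recursive_on_add: "recursive_on 2 (\<lambda>xs. xs ! 0 + xs ! 1)"
proof -
  have "recursive_on 2 (\<lambda>xs. rec_nat (xs ! 1) (\<lambda>k r. Suc r) (xs ! 0))"
    by (intro recursive_on_rec2 recursive_on_Suc recursive_on_proj) auto
  moreover have "rec_nat b (\<lambda>k r. Suc r) a = a + b" for a b
    by (induction a) auto
  ultimately show ?thesis by simp
qed

text \<open>The predecessor is primitive recursion that returns the counter and ignores the previous
  value; the recursion scheme has a spare second argument, which is filled by a copy of the first.\<close>

lemma recursive_on_pred: "recursive_on 1 (\<lambda>xs. xs ! 0 - 1)"
proof -
  have "recursive_on 2 (\<lambda>xs. rec_nat 0 (\<lambda>k r. k) (xs ! 0))"
    by (intro recursive_on_rec2 recursive_on_const recursive_on_proj) auto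
  moreover have "rec_nat 0 (\<lambda>k r. k) a = a - 1" for a :: nat
    by (cases a) auto
  ultimately have "recursive_on 2 (\<lambda>xs. xs ! 0 - 1)" by simp
  from recursive_on_comp2[OF this, of 1 "\<lambda>xs. xs ! 0" "\<lambda>xs. xs ! 0"]
  show ?thesis by (simp add: recursive_on_proj)
qed

lemma recursive_on_diff: "recursive_on 2 (\<lambda>xs. xs ! 0 - xs ! 1)"
proof -
  have "recursive_on 2 (\<lambda>xs. rec_nat (xs ! 1) (\<lambda>k r. r - 1) (xs ! 0))"
    by (intro recursive_on_rec2 recursive_on_comp1[OF recursive_on_pred] recursive_on_proj) auto
  moreover have "rec_nat b (\<lambda>k r. r - 1) a = b - a" for a b :: nat
    by (induction a) auto
  ultimately have "recursive_on 2 (\<lambda>xs. xs ! 1 - xs ! 0)" by simp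
  from recursive_on_comp2[OF this, of 2 "\<lambda>xs. xs ! 1" "\<lambda>xs. xs ! 0"]
  show ?thesis by (simp add: recursive_on_proj)
qed

lemma recursive_on_triangle: "recursive_on 1 (\<lambda>xs. triangle (xs ! 0))"
proof -
  have "recursive_on 2 (\<lambda>xs. rec_nat 0 (\<lambda>k r. r + Suc k) (xs ! 0))"
    by (intro recursive_on_rec2 recursive_on_comp2[OF recursive_on_add]
        recursive_on_Suc recursive_on_const recursive_on_proj) auto
  moreover have "rec_nat 0 (\<lambda>k r. r + Suc k) a = triangle a" for a
    by (induction a) auto
  ultimately have "recursive_on 2 (\<lambda>xs. triangle (xs ! 0))" by simp
  from recursive_on_comp2[OF this, of 1 "\<lambda>xs. xs ! 0" "\<lambda>xs. xs ! 0"]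
  show ?thesis by (simp add: recursive_on_proj)
qed

lemma recursive_on_prod_encode: "recursive_on 2 (\<lambda>xs. prod_encode (xs ! 0, xs ! 1))"
  unfolding prod_encode_def split
  by (intro recursive_on_comp2[OF recursive_on_add] recursive_on_comp1[OF recursive_on_triangle]
      recursive_on_proj) auto

abbreviation pfst :: "nat \<Rightarrow> nat" where "pfst z \<equiv> fst (prod_decode z)"
abbreviation psnd :: "nat \<Rightarrow> nat" where "psnd z \<equiv> snd (prod_decode z)"

lemma triangle_mono: "m \<le> n \<Longrightarrow> triangle m \<le> triangle n"
  by (induction n rule: dec_induct) auto

text \<open>Cantor pairing numbers the pairs diagonal by diagonal, and the \<open>k\<close>-th diagonal starts at
  \<open>triangle k\<close>. So the diagonal of a pair is the least \<open>k\<close> whose successor starts beyond its code.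
  Minimisation finds it, and both components are then differences.\<close>

lemma diagonal_eq_Least: "pfst z + psnd z = (LEAST k. Suc z - triangle (Suc k) = 0)"
proof -
  obtain m n where z: "z = prod_encode (m, n)"
    by (metis prod_decode_inverse surj_pair)
  have "(LEAST k. Suc z - triangle (Suc k) = 0) = m + n"
  proof (rule Least_equality)
    show "Suc z - triangle (Suc (m + n)) = 0"
      by (simp add: z prod_encode_def)
    show "m + n \<le> k" if "Suc z - triangle (Suc k) = 0" for k
    proof (rule ccontr)
      assume "\<not> m + n \<le> k"
      then have "triangle (Suc k) \<le> triangle (m + n)"
        by (intro triangle_mono) simp
      then show False using that by (simp add: z prod_encode_def)
    qed
  qed
  then show ?thesis by (simp add: z)
qed

lemma recursive_on_diagonal: "recursive_on 1 (\<lambda>xs. pfst (xs ! 0) + psnd (xs ! 0))"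
proof -
  define f where "f ys = Suc (ys ! 1) - triangle (Suc (ys ! 0))" for ys :: "nat list"
  have "recursive_on (Suc 1) f"
    unfolding f_def
    by (intro recursive_on_comp2[OF recursive_on_diff] recursive_on_Suc
        recursive_on_comp1[OF recursive_on_triangle] recursive_on_proj) auto
  moreover have "\<exists>k. f (k # xs) = 0" for xs
    by (rule exI[of _ "xs ! 0"]) (simp add: f_def)
  ultimately have "recursive_on 1 (\<lambda>xs. LEAST k. f (k # xs) = 0)"
    by (rule recursive_on_minim)
  then show ?thesis
    by (rule recursive_on_cong) (simp add: f_def diagonal_eq_Least)
qed

lemma pfst_eq: "pfst z = z - triangle (pfst z + psnd z)"
proof -
  obtain m n where z: "z = prod_encode (m, n)"
    by (metis prod_decode_inverse surj_pair)
  have "prod_encode (m, n) = triangle (m + n) + m" by (simp add: prod_encode_def)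
  then have "m = prod_encode (m, n) - triangle (m + n)" by simp
  then show ?thesis by (simp add: z)
qed

lemma recursive_on_pfst: "recursive_on 1 (\<lambda>xs. pfst (xs ! 0))"
  by (subst pfst_eq)
    (intro recursive_on_comp2[OF recursive_on_diff] recursive_on_comp1[OF recursive_on_triangle]
      recursive_on_diagonal recursive_on_proj, auto)

lemma recursive_on_psnd: "recursive_on 1 (\<lambda>xs. psnd (xs ! 0))"
proof -
  have "recursive_on 1 (\<lambda>xs. (pfst (xs ! 0) + psnd (xs ! 0)) - pfst (xs ! 0))"
    by (intro recursive_on_comp2[OF recursive_on_diff] recursive_on_diagonal recursive_on_pfst)
  then show ?thesis by simp
qed


section \<open>Computable functions of one argument\<close>

text \<open>Since pairing and its inverses are recursive, one argument suffices: an environment of several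
  variables is a nested pair, and a bound variable is added by pairing it with the environment.
  The rules below therefore have premises such as \<open>decidable (\<lambda>z. P (pfst z) (psnd z))\<close>, where
  the first component is the bound variable and the second is the old environment. With them the
  computability of a compound expression is proved by following its syntax.\<close>

definition computable :: "(nat \<Rightarrow> nat) \<Rightarrow> bool" where
  "computable f \<longleftrightarrow> recursive_on 1 (\<lambda>xs. f (xs ! 0))"

definition decidable :: "(nat \<Rightarrow> bool) \<Rightarrow> bool" where
  "decidable P \<longleftrightarrow> computable (\<lambda>x. of_bool (P x))"

lemma computable_compose: "computable f \<Longrightarrow> computable g \<Longrightarrow> computable (\<lambda>x. f (g x))"
  unfolding computable_def by (rule recursive_on_comp1)

lemma decidable_compose: "decidable P \<Longrightarrow> computable g \<Longrightarrow> decidable (\<lambda>x. P (g x))"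
  unfolding decidable_def by (rule computable_compose)

lemma computable_binary:
  assumes "recursive_on 2 (\<lambda>ys. f (ys ! 0) (ys ! 1))" "computable g" "computable h"
  shows "computable (\<lambda>x. f (g x) (h x))"
  using assms unfolding computable_def by (rule recursive_on_comp2)

lemma computable_id: "computable (\<lambda>x. x)"
  unfolding computable_def by (intro recursive_on_proj) simp

lemma computable_const: "computable (\<lambda>x. c)"
  unfolding computable_def by (rule recursive_on_const)

lemma computable_Suc: "computable f \<Longrightarrow> computable (\<lambda>x. Suc (f x))"
  unfolding computable_def by (rule recursive_on_Suc)

lemma computable_pair: "computable f \<Longrightarrow> computable g \<Longrightarrow> computable (\<lambda>x. prod_encode (f x, g x))"
  by (rule computable_binary[OF recursive_on_prod_encode])

lemma computable_pfst: "computable f \<Longrightarrow> computable (\<lambda>x. pfst (f x))"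
  unfolding computable_def by (rule recursive_on_comp1[OF recursive_on_pfst])

lemma computable_psnd: "computable f \<Longrightarrow> computable (\<lambda>x. psnd (f x))"
  unfolding computable_def by (rule recursive_on_comp1[OF recursive_on_psnd])

lemma computable_add: "computable f \<Longrightarrow> computable g \<Longrightarrow> computable (\<lambda>x. f x + g x)"
  by (rule computable_binary[OF recursive_on_add])

lemma computable_diff: "computable f \<Longrightarrow> computable g \<Longrightarrow> computable (\<lambda>x. f x - g x)"
  by (rule computable_binary[OF recursive_on_diff])

lemma computable_rec_nat:
  assumes b: "computable b" and f: "computable f"
    and h: "computable (\<lambda>z. h (pfst (pfst z)) (psnd (pfst z)) (psnd z))"
  shows "computable (\<lambda>x. rec_nat (f x) (\<lambda>k r. h k r x) (b x))"
proof -
  have "recursive_on 3 (\<lambda>ys. prod_encode (prod_encode (ys ! 0, ys ! 1), ys ! 2))"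
    by (intro recursive_on_comp2[OF recursive_on_prod_encode] recursive_on_proj) auto
  from recursive_on_comp1[OF h[unfolded computable_def] this]
  have "recursive_on 3 (\<lambda>ys. h (ys ! 0) (ys ! 1) (ys ! 2))" by simp
  from recursive_on_rec2[OF f[unfolded computable_def] this]
  show ?thesis using b computable_id by (rule computable_binary)
qed

lemma computable_If:
  assumes "decidable P" "computable f" "computable g"
  shows "computable (\<lambda>x. if P x then f x else g x)"
proof -
  have "computable (\<lambda>x. rec_nat (g x) (\<lambda>k r. f x) (of_bool (P x)))"
    using assms unfolding decidable_def
    by (intro computable_rec_nat computable_compose[OF assms(2)] computable_psnd computable_id)
  moreover have "rec_nat (g x) (\<lambda>k r. f x) (of_bool (P x)) = (if P x then f x else g x)" for x
    by simp
  ultimately show ?thesis by simp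
qed

lemma decidable_const: "decidable (\<lambda>x. c)"
  unfolding decidable_def by (rule computable_const)

lemma decidable_not:
  assumes "decidable P"
  shows "decidable (\<lambda>x. \<not> P x)"
proof -
  have "computable (\<lambda>x. 1 - of_bool (P x))"
    using assms unfolding decidable_def by (intro computable_diff computable_const)
  moreover have "1 - of_bool (P x) = (of_bool (\<not> P x) :: nat)" for x by simp
  ultimately show ?thesis unfolding decidable_def by (simp only:)
qed

lemma decidable_conj:
  assumes "decidable P" "decidable Q"
  shows "decidable (\<lambda>x. P x \<and> Q x)"
proof -
  have "computable (\<lambda>x. if P x then of_bool (Q x) else 0)"
    using assms unfolding decidable_def[of Q] by (intro computable_If computable_const)
  moreover have "(if P x then of_bool (Q x) else 0) = (of_bool (P x \<and> Q x) :: nat)" for x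
    by simp
  ultimately show ?thesis unfolding decidable_def by simp
qed

lemma decidable_disj: "decidable P \<Longrightarrow> decidable Q \<Longrightarrow> decidable (\<lambda>x. P x \<or> Q x)"
  using decidable_not[OF decidable_conj[OF decidable_not decidable_not], of P Q] by simp

lemma decidable_imp: "decidable P \<Longrightarrow> decidable Q \<Longrightarrow> decidable (\<lambda>x. P x \<longrightarrow> Q x)"
  unfolding imp_conv_disj by (intro decidable_disj decidable_not)

lemma decidable_less:
  assumes "computable f" "computable g"
  shows "decidable (\<lambda>x. f x < g x)"
proof -
  have "computable (\<lambda>x. rec_nat 0 (\<lambda>k r. 1) (g x - f x))"
    using assms by (intro computable_rec_nat computable_const computable_diff)
  moreover have "rec_nat 0 (\<lambda>k r. 1) n = (of_bool (0 < n) :: nat)" for n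
    by (cases n) auto
  ultimately show ?thesis unfolding decidable_def by simp
qed

lemma decidable_le: "computable f \<Longrightarrow> computable g \<Longrightarrow> decidable (\<lambda>x. f x \<le> g x)"
  using decidable_not[OF decidable_less, of g f] by (simp add: not_less)

lemma decidable_eq: "computable f \<Longrightarrow> computable g \<Longrightarrow> decidable (\<lambda>x. f x = g x)"
  using decidable_conj[OF decidable_le decidable_le, of f g g f] by (simp add: eq_iff)

lemma computable_Least:
  assumes P: "decidable (\<lambda>z. P (pfst z) (psnd z))" and ex: "\<And>x. \<exists>k. P k x"
  shows "computable (\<lambda>x. LEAST k. P k x)"
proof -
  define f where "f = (\<lambda>ys. of_bool (\<not> P (ys ! 0) (ys ! 1)) :: nat)"
  have "computable (\<lambda>z. of_bool (\<not> P (pfst z) (psnd z)))"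
    using decidable_not[OF P] unfolding decidable_def .
  from recursive_on_comp1[OF this[unfolded computable_def] recursive_on_prod_encode]
  have "recursive_on (Suc 1) f"
    by (simp add: numeral_2_eq_2 f_def)
  moreover have "\<exists>k. f (k # xs) = 0" for xs
    using ex by (simp add: f_def)
  ultimately have "recursive_on 1 (\<lambda>xs. LEAST k. f (k # xs) = 0)"
    by (rule recursive_on_minim)
  then show ?thesis by (simp add: computable_def f_def)
qed

lemmas computable_basic =
  computable_id computable_Suc computable_pair computable_pfst computable_psnd
  computable_add computable_diff computable_If computable_const
  decidable_not decidable_conj decidable_disj decidable_imp
  decidable_less decidable_le decidable_eq decidable_const

text \<open>The bounded search stops at the first witness or at the bound, so it is a minimisation that
  always succeeds, and a witness exists exactly if it stops before the bound.\<close>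

lemma decidable_bex_less:
  assumes "decidable (\<lambda>z. P (pfst z) (psnd z))" "computable b"
  shows "decidable (\<lambda>x. \<exists>k<b x. P k x)"
proof -
  have "decidable (\<lambda>x. (LEAST k. P k x \<or> b x \<le> k) < b x)"
    using assms by (intro computable_basic computable_Least computable_compose[OF assms(2)]) auto
  moreover have "(LEAST k. P k x \<or> b x \<le> k) < b x \<longleftrightarrow> (\<exists>k<b x. P k x)" for x
  proof
    assume "(LEAST k. P k x \<or> b x \<le> k) < b x"
    moreover have "P (LEAST k. P k x \<or> b x \<le> k) x \<or> b x \<le> (LEAST k. P k x \<or> b x \<le> k)"
      by (rule LeastI[of _ "b x"]) simp
    ultimately show "\<exists>k<b x. P k x" by (meson not_le)
  next
    assume "\<exists>k<b x. P k x"
    then obtain k where k: "k < b x" "P k x" by blast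
    have "(LEAST k. P k x \<or> b x \<le> k) \<le> k"
      by (rule Least_le) (simp add: k)
    then show "(LEAST k. P k x \<or> b x \<le> k) < b x" using k by simp
  qed
  ultimately show ?thesis by simp
qed

lemma decidable_ball_less:
  assumes "decidable (\<lambda>z. P (pfst z) (psnd z))" "computable b"
  shows "decidable (\<lambda>x. \<forall>k<b x. P k x)"
proof -
  have "decidable (\<lambda>x. \<not> (\<exists>k<b x. \<not> P k x))"
    by (intro decidable_not decidable_bex_less assms)
  then show ?thesis by simp
qed

lemma decidable_finite_bex:
  assumes "finite I" "\<And>i. i \<in> I \<Longrightarrow> decidable (P i)"
  shows "decidable (\<lambda>x. \<exists>i\<in>I. P i x)"
  using assms by (induction I rule: finite_induct)
    (simp_all add: decidable_const decidable_disj decidable_conj)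

lemma decidable_finite_ball:
  assumes "finite I" "\<And>i. i \<in> I \<Longrightarrow> decidable (P i)"
  shows "decidable (\<lambda>x. \<forall>i\<in>I. P i x)"
  using assms by (induction I rule: finite_induct)
    (simp_all add: decidable_const decidable_disj decidable_conj)

lemma decidable_finite_mem: "finite I \<Longrightarrow> computable f \<Longrightarrow> decidable (\<lambda>x. f x \<in> I)"
  using decidable_finite_bex[of I "\<lambda>i x. f x = i"] by (simp add: decidable_eq computable_const)

lemma computable_mult:
  assumes "computable f" "computable g"
  shows "computable (\<lambda>x. f x * g x)"
proof -
  have "computable (\<lambda>x. rec_nat 0 (\<lambda>k r. r + f x) (g x))"
    using assms by (intro computable_rec_nat computable_basic computable_compose[OF assms(1)])
  moreover have "rec_nat 0 (\<lambda>k r. r + a) b = a * b" for a b :: nat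
    by (induction b) auto
  ultimately show ?thesis by simp
qed

lemma computable_div:
  assumes "0 < c" and f: "computable f"
  shows "computable (\<lambda>x. f x div c)"
proof -
  have "computable (\<lambda>x. LEAST q. x < c * Suc q)"
  proof (rule computable_Least)
    show "decidable (\<lambda>z. psnd z < c * Suc (pfst z))"
      by (intro computable_basic computable_mult)
    show "\<exists>q. x < c * Suc q" for x
      using dividend_less_times_div[OF assms(1), of x] by auto
  qed
  moreover have "(LEAST q. x < c * Suc q) = x div c" for x
  proof (rule Least_equality)
    show "x < c * Suc (x div c)"
      using dividend_less_times_div[OF assms(1), of x] by simp
    show "x div c \<le> q" if "x < c * Suc q" for q
      using that assms(1) by (metis less_mult_imp_div_less less_Suc_eq_le mult.commute)
  qed
  ultimately have "computable (\<lambda>x. x div c)" by simp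
  then show ?thesis using f by (rule computable_compose)
qed

section \<open>Finite sets and finite functions coded by numbers\<close>

text \<open>Numbers code finite sets through their binary digits. The elements are smaller than the code,
  which makes quantifiers over a coded set bounded.\<close>

lemma mem_set_decode_less: "n \<in> set_decode d \<Longrightarrow> n < d"
proof -
  assume "n \<in> set_decode d"
  then have "d div 2 ^ n \<noteq> 0" unfolding set_decode_def by (intro notI) simp
  then have "2 ^ n \<le> d" by (simp add: div_eq_0_iff)
  then show "n < d" using less_exp[of n] by linarith
qed

lemma decidable_mem:
  assumes "computable f" "computable g"
  shows "decidable (\<lambda>x. f x \<in> set_decode (g x))"
proof -
  have q: "rec_nat d (\<lambda>k r. r div 2) n = d div 2 ^ n" for d n :: nat
    by (induction n) (auto simp: div_mult2_eq[symmetric] mult.commute)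
  have "computable (\<lambda>x. rec_nat (g x) (\<lambda>k r. r div 2) (f x))"
    using assms by (intro computable_rec_nat computable_basic computable_div) auto
  then have c: "computable (\<lambda>x. g x div 2 ^ f x)" by (simp add: q)
  have "decidable (\<lambda>x. \<not> (g x div 2 ^ f x = 2 * (g x div 2 ^ f x div 2)))"
    by (intro computable_basic computable_mult computable_div c) simp
  moreover have "\<not> (n = 2 * (n div 2)) \<longleftrightarrow> odd n" for n :: nat by presburger
  ultimately show ?thesis by (simp add: set_decode_def)
qed

lemma decidable_ball_mem:
  assumes "decidable (\<lambda>z. P (pfst z) (psnd z))" "computable f"
  shows "decidable (\<lambda>x. \<forall>a\<in>set_decode (f x). P a x)"
proof -
  have "decidable (\<lambda>x. \<forall>a<f x. a \<in> set_decode (f x) \<longrightarrow> P a x)"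
    by (intro decidable_ball_less decidable_imp decidable_mem assms computable_basic
        computable_compose[OF assms(2)])
  moreover have "(\<forall>a<f x. a \<in> set_decode (f x) \<longrightarrow> P a x) \<longleftrightarrow> (\<forall>a\<in>set_decode (f x). P a x)" for x
    by (auto dest: mem_set_decode_less)
  ultimately show ?thesis by simp
qed

lemma decidable_bex_mem:
  assumes "decidable (\<lambda>z. P (pfst z) (psnd z))" "computable f"
  shows "decidable (\<lambda>x. \<exists>a\<in>set_decode (f x). P a x)"
proof -
  have "decidable (\<lambda>x. \<not> (\<forall>a\<in>set_decode (f x). \<not> P a x))"
    by (intro decidable_not decidable_ball_mem assms)
  then show ?thesis by simp
qed

lemma computable_set_encode:
  assumes P: "decidable (\<lambda>z. P (pfst z) (psnd z))" and b: "computable b"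
  shows "computable (\<lambda>x. set_encode {k. k < b x \<and> P k x})"
proof -
  have "computable (\<lambda>n. rec_nat 1 (\<lambda>k r. r + r) n)"
    by (intro computable_rec_nat computable_basic)
  moreover have "rec_nat 1 (\<lambda>k r. r + r) n = (2::nat) ^ n" for n
    by (induction n) auto
  ultimately have pow: "computable (\<lambda>n. 2 ^ n)" by simp
  have "decidable (\<lambda>z. P (pfst (pfst z)) (psnd z))"
    using decidable_compose[OF P, of "\<lambda>z. prod_encode (pfst (pfst z), psnd z)"]
    by (simp add: computable_basic)
  then have "computable (\<lambda>x. rec_nat 0 (\<lambda>k r. if P k x then r + 2 ^ k else r) (b x))"
    using b by (intro computable_rec_nat computable_basic computable_compose[OF pow]) auto
  moreover have "rec_nat 0 (\<lambda>k r. if P k x then r + 2 ^ k else r) n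
      = set_encode {k. k < n \<and> P k x}" for n x
  proof (induction n)
    case (Suc n)
    have "{k. k < Suc n \<and> P k x} = (if P n x then insert n {k. k < n \<and> P k x} else {k. k < n \<and> P k x})"
      by (auto simp: less_Suc_eq)
    then show ?case by (simp add: Suc set_encode_insert add.commute)
  qed simp
  ultimately show ?thesis by simp
qed

text \<open>A finite function is coded by its graph. The disjunct \<open>t \<le> c\<close> makes the search succeed
  outside the domain; inside the domain it is harmless, because a value is always smaller than the
  code of the graph.\<close>

definition apply_table :: "nat \<Rightarrow> nat \<Rightarrow> nat" where
  "apply_table t n = (LEAST c. prod_encode (n, c) \<in> set_decode t \<or> t \<le> c)"

lemma computable_apply_table:
  assumes "computable f" "computable g"
  shows "computable (\<lambda>x. apply_table (f x) (g x))"
proof -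
  have "computable (\<lambda>z. apply_table (pfst z) (psnd z))"
    unfolding apply_table_def
    by (intro computable_Least computable_basic decidable_mem) auto
  from computable_compose[OF this computable_pair[OF assms]] show ?thesis by simp
qed

lemma ex_table:
  assumes "finite A"
  obtains t where "\<And>n. n \<in> A \<Longrightarrow> apply_table t n = f n"
proof -
  define t where "t = set_encode ((\<lambda>n. prod_encode (n, f n)) ` A)"
  have mem: "set_decode t = (\<lambda>n. prod_encode (n, f n)) ` A"
    unfolding t_def using assms by (intro set_encode_inverse) simp
  have "apply_table t n = f n" if n: "n \<in> A" for n
    unfolding apply_table_def
  proof (rule Least_equality)
    show "prod_encode (n, f n) \<in> set_decode t \<or> t \<le> f n" using n mem by blast
    have "prod_encode (n, f n) < t"
      using n mem by (intro mem_set_decode_less) blast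
    then have "f n < t" using le_prod_encode_2[of "f n" n] by linarith
    then show "f n \<le> c" if "prod_encode (n, c) \<in> set_decode t \<or> t \<le> c" for c
      using that by (auto simp: mem)
  qed
  then show ?thesis by (rule that)
qed

section \<open>Structural recursion on words\<close>

lemma code_inject: "code u = code v \<Longrightarrow> u = v"
proof (induction u arbitrary: v)
  case (Gen i)
  then show ?case by (cases v) (auto, presburger+)
next
  case (Star u1 u2)
  from Star.prems have "\<exists>v1 v2. v = Star v1 v2"
    by (cases v) (auto, presburger+)
  then show ?case using Star by auto
next
  case (Div u1 u2)
  from Div.prems have "\<exists>v1 v2. v = Div v1 v2"
    by (cases v) (auto, presburger+)
  then show ?case using Div by auto
qed

primrec fold_word ::
  "(nat \<Rightarrow> nat) \<Rightarrow> (nat \<Rightarrow> nat \<Rightarrow> nat) \<Rightarrow> (nat \<Rightarrow> nat \<Rightarrow> nat) \<Rightarrow> qword \<Rightarrow> nat" where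
  "fold_word g s d (Gen i) = g i"
| "fold_word g s d (Star u v) = s (fold_word g s d u) (fold_word g s d v)"
| "fold_word g s d (Div u v) = d (fold_word g s d u) (fold_word g s d v)"

text \<open>One level of \<open>fold_word\<close> on codes, where the function \<open>T\<close> supplies the values at the subwords.
  The remainder \<open>n - 3 * p\<close> identifies the outermost constructor.\<close>

definition word_step ::
  "(nat \<Rightarrow> nat) \<Rightarrow> (nat \<Rightarrow> nat \<Rightarrow> nat) \<Rightarrow> (nat \<Rightarrow> nat \<Rightarrow> nat) \<Rightarrow> (nat \<Rightarrow> nat) \<Rightarrow> nat \<Rightarrow> nat" where
  "word_step g s d T n =
    (let p = n div 3 in
     if n - 3 * p = 0 then g p
     else if n - 3 * p = 1 then s (T (pfst p)) (T (psnd p))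
     else d (T (pfst p)) (T (psnd p)))"

lemma word_step_code:
  "word_step g s d T (code (Gen i)) = g i"
  "word_step g s d T (code (Star u v)) = s (T (code u)) (T (code v))"
  "word_step g s d T (code (Div u v)) = d (T (code u)) (T (code v))"
proof -
  have "Suc (3 * p) div 3 = p" "Suc (Suc (3 * p)) div 3 = p" for p :: nat
    by presburger+
  then show
    "word_step g s d T (code (Gen i)) = g i"
    "word_step g s d T (code (Star u v)) = s (T (code u)) (T (code v))"
    "word_step g s d T (code (Div u v)) = d (T (code u)) (T (code v))"
    by (simp_all add: word_step_def Let_def)
qed

lemma code_less:
  "code u < code (Star u v)" "code v < code (Star u v)"
  "code u < code (Div u v)" "code v < code (Div u v)"
  using le_prod_encode_1[of "code u" "code v"] le_prod_encode_2[of "code v" "code u"] by auto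

text \<open>Every number codes a word, as the three residues modulo 3 belong to the three constructors and
  pairing is surjective. Hence \<open>word_of\<close> inverts \<open>code\<close>, and quantifying over numbers is
  quantifying over words.\<close>

lemma surj_code: "\<exists>u. code u = n"
proof (induction n rule: less_induct)
  case (less n)
  define p where "p = n div 3"
  consider "n = 3 * p" | "n = 3 * p + 1" | "n = 3 * p + 2"
    unfolding p_def by linarith
  then show ?case
  proof cases
    case 1
    then show ?thesis by (intro exI[of _ "Gen p"]) simp
  next
    case 2
    moreover have "pfst p \<le> p" "psnd p \<le> p"
      using le_prod_encode_1[of "pfst p" "psnd p"] le_prod_encode_2[of "psnd p" "pfst p"] by auto
    ultimately obtain u v where "code u = pfst p" "code v = psnd p"
      using less.IH[of "pfst p"] less.IH[of "psnd p"] by auto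
    then show ?thesis using 2 by (intro exI[of _ "Star u v"]) simp
  next
    case 3
    moreover have "pfst p \<le> p" "psnd p \<le> p"
      using le_prod_encode_1[of "pfst p" "psnd p"] le_prod_encode_2[of "psnd p" "pfst p"] by auto
    ultimately obtain u v where "code u = pfst p" "code v = psnd p"
      using less.IH[of "pfst p"] less.IH[of "psnd p"] by auto
    then show ?thesis using 3 by (intro exI[of _ "Div u v"]) simp
  qed
qed

definition word_of :: "nat \<Rightarrow> qword" where
  "word_of n = (THE u. code u = n)"

lemma word_of_code [simp]: "word_of (code u) = u"
  unfolding word_of_def by (rule the_equality) (auto dest: code_inject)

lemma code_word_of [simp]: "code (word_of n) = n"
  using surj_code[of n] by auto

text \<open>Recursion on words descends to two smaller codes at once and is not primitive recursion. But
  the values at all codes up to the given one form a finite table, the recursion equations of the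
  table can be checked with a bounded quantifier, and a table satisfying them holds the right values.
  So search for the least such table and look up the value.\<close>

lemma computable_fold_word:
  assumes g: "computable (\<lambda>z. g (psnd z) (pfst z))"
    and s: "computable (\<lambda>z. s (psnd z) (pfst (pfst z)) (psnd (pfst z)))"
    and d: "computable (\<lambda>z. d (psnd z) (pfst (pfst z)) (psnd (pfst z)))"
    and b: "computable b"
  shows "computable (\<lambda>x. fold_word (g x) (s x) (d x) (word_of (b x)))"
proof -
  define ok where "ok t x \<longleftrightarrow>
    (\<forall>n<Suc (b x). apply_table t n = word_step (g x) (s x) (d x) (apply_table t) n)" for t x
  have value_of: "apply_table t (code u) = fold_word (g x) (s x) (d x) u"
    if "ok t x" "code u \<le> b x" for t x u
    using that(2)
  proof (induction u)
    case (Gen i)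
    then show ?case using that(1) unfolding ok_def by (metis word_step_code(1) fold_word.simps(1) le_imp_less_Suc)
  next
    case (Star u v)
    then have "apply_table t (code (Star u v)) = s x (apply_table t (code u)) (apply_table t (code v))"
      using that(1) unfolding ok_def by (metis word_step_code(2) le_imp_less_Suc)
    moreover have "code u \<le> b x" "code v \<le> b x"
      using Star.prems code_less(1,2)[where u=u and v=v] by linarith+
    ultimately show ?case using Star.IH by simp
  next
    case (Div u v)
    then have "apply_table t (code (Div u v)) = d x (apply_table t (code u)) (apply_table t (code v))"
      using that(1) unfolding ok_def by (metis word_step_code(3) le_imp_less_Suc)
    moreover have "code u \<le> b x" "code v \<le> b x"
      using Div.prems code_less(3,4)[where u=u and v=v] by linarith+
    ultimately show ?case using Div.IH by simp
  qed
  have ex: "\<exists>t. ok t x" for x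
  proof -
    define f where "f n = fold_word (g x) (s x) (d x) (word_of n)" for n
    obtain t where t: "\<And>n. n \<in> {..b x} \<Longrightarrow> apply_table t n = f n"
      using ex_table[of "{..b x}" f] by blast
    have "apply_table t n = word_step (g x) (s x) (d x) (apply_table t) n" if "n \<le> b x" for n
    proof (cases "word_of n")
      case (Gen i)
      then have "n = code (Gen i)" by (metis code_word_of)
      then show ?thesis using t[of n] that by (simp add: f_def word_step_code del: code.simps)
    next
      case (Star u v)
      then have n: "n = code (Star u v)" by (metis code_word_of)
      then have "code u \<le> b x" "code v \<le> b x" using code_less(1,2)[where u=u and v=v] that by auto
      then show ?thesis using t[of n] t[of "code u"] t[of "code v"] that
        by (simp add: f_def n word_step_code del: code.simps)
    next
      case (Div u v)
      then have n: "n = code (Div u v)" by (metis code_word_of)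
      then have "code u \<le> b x" "code v \<le> b x" using code_less(3,4)[where u=u and v=v] that by auto
      then show ?thesis using t[of n] t[of "code u"] t[of "code v"] that
        by (simp add: f_def n word_step_code del: code.simps)
    qed
    then show ?thesis unfolding ok_def by (intro exI[of _ t]) simp
  qed
  have g': "computable (\<lambda>z. g (e z) (f z))" if "computable e" "computable f" for e f
    using computable_compose[OF g computable_pair[OF that(2) that(1)]] by simp
  have s': "computable (\<lambda>z. s (e z) (f z) (h z))" if "computable e" "computable f" "computable h" for e f h
    using computable_compose[OF s computable_pair[OF computable_pair[OF that(2,3)] that(1)]] by simp
  have d': "computable (\<lambda>z. d (e z) (f z) (h z))" if "computable e" "computable f" "computable h" for e f h
    using computable_compose[OF d computable_pair[OF computable_pair[OF that(2,3)] that(1)]] by simp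
  have "computable (\<lambda>x. LEAST t. ok t x)"
  proof (rule computable_Least)
    show "decidable (\<lambda>z. ok (pfst z) (psnd z))"
      unfolding ok_def word_step_def Let_def
      by (intro decidable_ball_less computable_basic computable_apply_table computable_div
          computable_mult g' s' d' computable_compose[OF b]) auto
  qed (rule ex)
  then have "computable (\<lambda>x. apply_table (LEAST t. ok t x) (b x))"
    using b by (intro computable_apply_table)
  moreover have "apply_table (LEAST t. ok t x) (b x) = fold_word (g x) (s x) (d x) (word_of (b x))" for x
    using value_of[of "LEAST t. ok t x" x "word_of (b x)"] LeastI_ex[OF ex] by simp
  ultimately show ?thesis by simp
qed

text \<open>Fold with addition the indicator of the symbols outside \<open>S\<close>: the sum counts their
  occurrences.\<close>

lemma decidable_words:
  assumes "finite S" "computable f"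
  shows "decidable (\<lambda>x. word_of (f x) \<in> words S)"
proof -
  have "computable (\<lambda>x. fold_word (\<lambda>i. of_bool (i \<notin> S)) (\<lambda>a b. a + b) (\<lambda>a b. a + b) (word_of (f x)))"
    by (intro computable_fold_word computable_basic assms(2)
        decidable_not[OF decidable_finite_mem, unfolded decidable_def, OF assms(1)])
  then have "decidable (\<lambda>x. fold_word (\<lambda>i. of_bool (i \<notin> S)) (\<lambda>a b. a + b) (\<lambda>a b. a + b) (word_of (f x)) = 0)"
    by (intro computable_basic)
  moreover have "fold_word (\<lambda>i. of_bool (i \<notin> S)) (\<lambda>a b. a + b) (\<lambda>a b. a + b) u = 0 \<longleftrightarrow> u \<in> words S" for u
    unfolding words_def by (induction u) auto
  ultimately show ?thesis by simp
qed


section \<open>Words and the quandles they present\<close>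

lemma words_simps [simp]:
  "Gen i \<in> words S \<longleftrightarrow> i \<in> S"
  "Star u v \<in> words S \<longleftrightarrow> u \<in> words S \<and> v \<in> words S"
  "Div u v \<in> words S \<longleftrightarrow> u \<in> words S \<and> v \<in> words S"
  by (auto simp: words_def)

context quandle
begin

lemma qdiv_unique: "\<lbrakk>x \<in> X; y \<in> X; z \<in> X; x = z \<star> y\<rbrakk> \<Longrightarrow> qdiv X (\<star>) x y = z"
  unfolding qdiv_def using right_div[of x y] by (intro the1_equality) auto

lemma qdiv_in:
  assumes "x \<in> X" "y \<in> X"
  shows "qdiv X (\<star>) x y \<in> X" and "qdiv X (\<star>) x y \<star> y = x"
proof -
  obtain z where "z \<in> X" "x = z \<star> y" using right_div[OF assms] by blast
  then show "qdiv X (\<star>) x y \<in> X" "qdiv X (\<star>) x y \<star> y = x"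
    using qdiv_unique[OF assms] by auto
qed

lemma qeval_in:
  assumes "\<forall>i\<in>S. g i \<in> X" "u \<in> words S"
  shows "qeval X (\<star>) g u \<in> X"
  using assms(2) by (induction u) (auto simp: assms(1) closed qdiv_in)

text \<open>One half of the universal property of \<open>\<langle>S | R\<rangle>\<close>: an assignment of the generators that satisfies
  the relations gives a well-defined map on the quotient.\<close>

lemma qcong_imp_qeval_eq:
  assumes g: "\<forall>i\<in>S. g i \<in> X" and R: "R \<subseteq> words S \<times> words S"
    and rels: "\<forall>r\<in>R. qeval X (\<star>) g (fst r) = qeval X (\<star>) g (snd r)"
    and "qcong S R u v"
  shows "u \<in> words S \<and> v \<in> words S \<and> qeval X (\<star>) g u = qeval X (\<star>) g v"
  using assms(4)
proof (induction rule: qcong.induct)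
  case (rel u v)
  then show ?case using R rels by fastforce
next
  case (star_div u v)
  then show ?case using qeval_in[OF g] by (auto intro!: qdiv_unique closed)
qed (auto simp: qeval_in[OF g] idem distrib qdiv_in)

end

lemma quandle_hom_qdiv:
  assumes "quandle X op" "quandle F op'" "quandle_hom X op F op' \<phi>" "x \<in> X" "y \<in> X"
  shows "\<phi> (qdiv X op x y) = qdiv F op' (\<phi> x) (\<phi> y)"
proof -
  interpret X: quandle X op by fact
  interpret F: quandle F op' by fact
  have "\<phi> x = op' (\<phi> (qdiv X op x y)) (\<phi> y)"
    using assms(3-5) X.qdiv_in[OF assms(4,5)] unfolding quandle_hom_def by metis
  then show ?thesis
    using assms(3-5) X.qdiv_in[OF assms(4,5)] unfolding quandle_hom_def
    by (intro F.qdiv_unique[symmetric]) auto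
qed

lemma quandle_hom_qeval:
  assumes "quandle X op" "quandle F op'" "quandle_hom X op F op' \<phi>"
    and g: "\<forall>i\<in>S. g i \<in> X" and u: "u \<in> words S"
  shows "qeval F op' (\<lambda>i. \<phi> (g i)) u = \<phi> (qeval X op g u)"
  using u
proof (induction u)
  case (Star u v)
  then show ?case using assms(3) quandle.qeval_in[OF assms(1) g] by (auto simp: quandle_hom_def)
next
  case (Div u v)
  then show ?case using quandle_hom_qdiv[OF assms(1-3)] quandle.qeval_in[OF assms(1) g] by auto
qed simp

text \<open>Words built from a set of words instead of from single symbols. They represent the subquandle
  generated by the elements that \<open>A\<close> represents, so they reduce membership in that subquandle to a
  statement about words.\<close>

inductive_set gen_words :: "qword set \<Rightarrow> qword set" for A where
  base: "a \<in> A \<Longrightarrow> a \<in> gen_words A"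
| Star: "u \<in> gen_words A \<Longrightarrow> v \<in> gen_words A \<Longrightarrow> Star u v \<in> gen_words A"
| Div: "u \<in> gen_words A \<Longrightarrow> v \<in> gen_words A \<Longrightarrow> Div u v \<in> gen_words A"

lemma gen_words_subset: "A \<subseteq> words S \<Longrightarrow> gen_words A \<subseteq> words S"
proof
  fix u assume "A \<subseteq> words S" "u \<in> gen_words A"
  from this(2,1) show "u \<in> words S" by (induction rule: gen_words.induct) auto
qed

text \<open>The elements represented by \<open>gen_words A\<close> form a subquandle, so they exhaust \<open>Y\<close> by
  minimality as soon as \<open>A\<close> represents the generators of \<open>Y\<close>.\<close>

lemma fin_gen_subquandle_words:
  assumes "qeval X op g ` words S = X" "fin_gen_subquandle X op Y"
  obtains A where "finite A" "A \<subseteq> words S" "Y = qeval X op g ` gen_words A"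
proof -
  obtain B where B: "finite B" "B \<subseteq> Y" and Y: "subquandle X op Y"
    and least: "\<And>Z. subquandle X op Z \<Longrightarrow> B \<subseteq> Z \<Longrightarrow> Y \<subseteq> Z"
    using assms(2) unfolding fin_gen_subquandle_def by auto
  have "B \<subseteq> qeval X op g ` words S" using B(2) Y assms(1) by (auto simp: subquandle_def)
  then obtain A where A: "A \<subseteq> words S" "finite A" "B = qeval X op g ` A"
    using finite_subset_image[OF B(1)] by blast
  have "Y \<subseteq> qeval X op g ` gen_words A"
  proof (rule least)
    show "B \<subseteq> qeval X op g ` gen_words A" using A(3) by (auto intro: gen_words.base)
    have "op (qeval X op g u) (qeval X op g v) \<in> qeval X op g ` gen_words A"
      "qdiv X op (qeval X op g u) (qeval X op g v) \<in> qeval X op g ` gen_words A"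
      if "u \<in> gen_words A" "v \<in> gen_words A" for u v
      using gen_words.Star[OF that] gen_words.Div[OF that] by (metis image_eqI qeval.simps)+
    then show "subquandle X op (qeval X op g ` gen_words A)"
      using gen_words_subset[OF A(1)] assms(1) unfolding subquandle_def by blast
  qed
  moreover have "qeval X op g u \<in> Y" if "u \<in> gen_words A" for u
    using that by induction (use A(3) B(2) Y in \<open>auto simp: subquandle_def\<close>)
  ultimately have "Y = qeval X op g ` gen_words A" by blast
  then show ?thesis using A that by blast
qed


section \<open>Enumerating the consequences of a presentation\<close>

definition star_code :: "nat \<Rightarrow> nat \<Rightarrow> nat" where
  "star_code a b = 3 * prod_encode (a, b) + 1"

definition div_code :: "nat \<Rightarrow> nat \<Rightarrow> nat" where
  "div_code a b = 3 * prod_encode (a, b) + 2"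

lemma code_eq_star_code: "code (Star u v) = star_code (code u) (code v)"
  by (simp add: star_code_def)

lemma code_eq_div_code: "code (Div u v) = div_code (code u) (code v)"
  by (simp add: div_code_def)

lemma word_of_star_code: "word_of (star_code a b) = Star (word_of a) (word_of b)"
  by (metis code_eq_star_code code_word_of word_of_code)

lemma word_of_div_code: "word_of (div_code a b) = Div (word_of a) (word_of b)"
  by (metis code_eq_div_code code_word_of word_of_code)

lemma computable_star_code: "computable f \<Longrightarrow> computable g \<Longrightarrow> computable (\<lambda>x. star_code (f x) (g x))"
  unfolding star_code_def by (intro computable_basic computable_mult)

lemma computable_div_code: "computable f \<Longrightarrow> computable g \<Longrightarrow> computable (\<lambda>x. div_code (f x) (g x))"
  unfolding div_code_def by (intro computable_basic computable_mult)

text \<open>Facts of two kinds are coded by one number: \<open>eq_fact u v\<close> says that the words with codes \<open>u\<close>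
  and \<open>v\<close> are congruent, \<open>mem_fact u\<close> that the word with code \<open>u\<close> is congruent to a word in
  \<open>gen_words A\<close>. The successor in the second component keeps the kinds apart.\<close>

abbreviation eq_fact :: "nat \<Rightarrow> nat \<Rightarrow> nat" where
  "eq_fact u v \<equiv> prod_encode (u, Suc v)"

abbreviation mem_fact :: "nat \<Rightarrow> nat" where
  "mem_fact u \<equiv> prod_encode (u, 0)"

text \<open>The equality of \<open>u\<close> and \<open>v\<close> follows in one step from the facts coded by \<open>d\<close>. The disjuncts are
  the rules of \<open>qcong\<close>; each quantifier is bounded, by \<open>u\<close> or \<open>v\<close> for subwords and by \<open>d\<close> for a
  middle term of transitivity, which occurs in a fact of \<open>d\<close>.\<close>

definition eq_step :: "nat set \<Rightarrow> (qword \<times> qword) set \<Rightarrow> nat \<Rightarrow> nat \<Rightarrow> nat \<Rightarrow> bool" where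
  "eq_step S R d u v \<longleftrightarrow>
     (\<exists>r\<in>R. u = code (fst r) \<and> v = code (snd r)) \<or>
     (word_of u \<in> words S \<and> u = v) \<or>
     eq_fact v u \<in> set_decode d \<or>
     (\<exists>w<d. eq_fact u w \<in> set_decode d \<and> eq_fact w v \<in> set_decode d) \<or>
     (\<exists>a<u. \<exists>b<u. \<exists>a'<v. \<exists>b'<v. eq_fact a a' \<in> set_decode d \<and> eq_fact b b' \<in> set_decode d \<and>
        (u = star_code a b \<and> v = star_code a' b' \<or> u = div_code a b \<and> v = div_code a' b')) \<or>
     (word_of v \<in> words S \<and> (u = star_code v v \<or>
        (\<exists>b<u. word_of b \<in> words S \<and>
           (u = div_code (star_code v b) b \<or> u = star_code (div_code v b) b)))) \<or>
     (\<exists>a<u. \<exists>b<u. \<exists>c<u. word_of a \<in> words S \<and> word_of b \<in> words S \<and> word_of c \<in> words S \<and>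
        u = star_code (star_code a b) c \<and> v = star_code (star_code a c) (star_code b c))"

definition mem_step :: "qword set \<Rightarrow> nat \<Rightarrow> nat \<Rightarrow> bool" where
  "mem_step A d u \<longleftrightarrow>
     (\<exists>a\<in>A. u = code a) \<or>
     (\<exists>a<u. \<exists>b<u. mem_fact a \<in> set_decode d \<and> mem_fact b \<in> set_decode d \<and>
        (u = star_code a b \<or> u = div_code a b)) \<or>
     (\<exists>a<d. mem_fact a \<in> set_decode d \<and> eq_fact a u \<in> set_decode d)"

definition fact_step :: "nat set \<Rightarrow> (qword \<times> qword) set \<Rightarrow> qword set \<Rightarrow> nat \<Rightarrow> nat \<Rightarrow> bool" where
  "fact_step S R A d x \<longleftrightarrow>
     (psnd x = 0 \<longrightarrow> mem_step A d (pfst x)) \<and>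
     (0 < psnd x \<longrightarrow> eq_step S R d (pfst x) (psnd x - 1))"

text \<open>A stage consists of the facts that follow in one step from the preceding stage and lie below
  the index, the bound being there to keep stages finite. Stages need not be recorded as increasing:
  it is enough that each consequence of the presentation belongs to all sufficiently late stages.\<close>

definition stage :: "nat set \<Rightarrow> (qword \<times> qword) set \<Rightarrow> qword set \<Rightarrow> nat \<Rightarrow> nat" where
  "stage S R A k = rec_nat 0 (\<lambda>k d. set_encode {x. x < k \<and> fact_step S R A d x}) k"

lemma decidable_eq_step:
  assumes "finite S" "finite R" and d: "computable d" "computable u" "computable v"
  shows "decidable (\<lambda>x. eq_step S R (d x) (u x) (v x))"
  unfolding eq_step_def
  by (intro computable_basic decidable_finite_bex[OF assms(2)] decidable_words[OF assms(1)]
      decidable_bex_less decidable_mem computable_star_code computable_div_code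
      d d[THEN computable_compose])

lemma decidable_mem_step:
  assumes "finite A" and d: "computable d" "computable u"
  shows "decidable (\<lambda>x. mem_step A (d x) (u x))"
  unfolding mem_step_def
  by (intro computable_basic decidable_finite_bex[OF assms(1)]
      decidable_bex_less decidable_mem computable_star_code computable_div_code
      d d[THEN computable_compose])

lemma computable_stage:
  assumes "finite S" "finite R" "finite A"
  shows "computable (stage S R A)"
  unfolding stage_def[abs_def] fact_step_def
  by (intro computable_rec_nat computable_basic computable_set_encode
      decidable_eq_step decidable_mem_step assms)

lemma mem_stage_Suc: "x \<in> set_decode (stage S R A (Suc k)) \<longleftrightarrow> x < k \<and> fact_step S R A (stage S R A k) x"
  by (simp add: stage_def set_encode_inverse)

lemma stage_sound:
  assumes "x \<in> set_decode (stage S R A k)" and A: "A \<subseteq> words S"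
  shows "(psnd x = 0 \<longrightarrow> (\<exists>t\<in>gen_words A. qcong S R (word_of (pfst x)) t)) \<and>
    (0 < psnd x \<longrightarrow> qcong S R (word_of (pfst x)) (word_of (psnd x - 1)))"
  using assms(1)
proof (induction k arbitrary: x)
  case 0
  then show ?case by (simp add: stage_def)
next
  case (Suc k)
  let ?d = "stage S R A k"
  have E: "qcong S R (word_of u) (word_of v)" if "eq_fact u v \<in> set_decode ?d" for u v
    using Suc.IH[OF that] by simp
  have M: "\<exists>t\<in>gen_words A. qcong S R (word_of u) t" if "mem_fact u \<in> set_decode ?d" for u
    using Suc.IH[OF that] by simp
  have eq: "qcong S R (word_of u) (word_of v)" if "eq_step S R ?d u v" for u v
    using that unfolding eq_step_def
    by (elim disjE exE bexE conjE)
      (auto simp: word_of_star_code word_of_div_code dest!: E intro: qcong.intros)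
  have mem: "\<exists>t\<in>gen_words A. qcong S R (word_of u) t" if "mem_step A ?d u" for u
    using that unfolding mem_step_def
  proof (elim disjE exE bexE conjE)
    fix a assume "a \<in> A" "u = code a"
    then show ?thesis using A by (auto intro!: bexI[of _ a] qcong.refl gen_words.base)
  next
    fix a b assume "mem_fact a \<in> set_decode ?d" "mem_fact b \<in> set_decode ?d"
    then obtain s t where *: "s \<in> gen_words A" "t \<in> gen_words A"
      "qcong S R (word_of a) s" "qcong S R (word_of b) t"
      using M by meson
    show ?thesis if "u = star_code a b"
      using * by (auto simp: that word_of_star_code intro!: bexI[of _ "Star s t"] gen_words.Star qcong.cong_Star)
    show ?thesis if "u = div_code a b"
      using * by (auto simp: that word_of_div_code intro!: bexI[of _ "Div s t"] gen_words.Div qcong.cong_Div)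
  next
    fix a assume "mem_fact a \<in> set_decode ?d" "eq_fact a u \<in> set_decode ?d"
    then show ?thesis using M E by (meson qcong.sym qcong.trans)
  qed
  show ?case using Suc.prems eq mem unfolding mem_stage_Suc fact_step_def by simp
qed

text \<open>If a fact follows in one step from every late stage, then it belongs to every late stage: the
  size bound only excludes it from finitely many. This turns each rule of \<open>qcong\<close> into a step of the
  completeness proof, as finitely many premises lie together in all late stages.\<close>

lemma eventually_stageI:
  assumes "\<forall>\<^sub>F k in sequentially. fact_step S R A (stage S R A k) x"
  shows "\<forall>\<^sub>F k in sequentially. x \<in> set_decode (stage S R A k)"
proof -
  have "\<forall>\<^sub>F k in sequentially. x \<in> set_decode (stage S R A (Suc k))"
    using assms eventually_gt_at_top[of x] by eventually_elim (simp add: mem_stage_Suc)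
  then show ?thesis
    by (rule eventually_sequentially_Suc[where P = "\<lambda>k. x \<in> set_decode (stage S R A k)", THEN iffD1])
qed

lemma eventually_eq_factI:
  assumes "\<forall>\<^sub>F k in sequentially. eq_step S R (stage S R A k) u v"
  shows "\<forall>\<^sub>F k in sequentially. eq_fact u v \<in> set_decode (stage S R A k)"
  using assms by (intro eventually_stageI) (simp add: fact_step_def)

lemma eventually_mem_factI:
  assumes "\<forall>\<^sub>F k in sequentially. mem_step A (stage S R A k) u"
  shows "\<forall>\<^sub>F k in sequentially. mem_fact u \<in> set_decode (stage S R A k)"
  using assms by (intro eventually_stageI) (simp add: fact_step_def)

lemma eq_fact_less: "eq_fact u v \<in> set_decode d \<Longrightarrow> u < d \<and> v < d"
  using mem_set_decode_less[of "eq_fact u v" d] le_prod_encode_1[of u "Suc v"]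
    le_prod_encode_2[of "Suc v" u] by auto

lemma eq_fact_complete:
  assumes "qcong S R u v"
  shows "\<forall>\<^sub>F k in sequentially. eq_fact (code u) (code v) \<in> set_decode (stage S R A k)"
  using assms
proof (induction rule: qcong.induct)
  case (rel u v)
  then show ?case by (intro eventually_eq_factI always_eventually) (force simp: eq_step_def)
next
  case (refl u)
  then show ?case by (intro eventually_eq_factI always_eventually) (simp add: eq_step_def)
next
  case (sym u v)
  have "\<forall>\<^sub>F k in sequentially. eq_step S R (stage S R A k) (code v) (code u)"
    using sym.IH by eventually_elim (simp add: eq_step_def)
  then show ?case by (rule eventually_eq_factI)
next
  case (trans u v w)
  have "\<forall>\<^sub>F k in sequentially. eq_step S R (stage S R A k) (code u) (code w)"
    using trans.IH by eventually_elim (auto simp: eq_step_def dest: eq_fact_less)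
  then show ?case by (rule eventually_eq_factI)
next
  case (cong_Star u u' v v')
  have "\<forall>\<^sub>F k in sequentially. eq_step S R (stage S R A k) (code (Star u v)) (code (Star u' v'))"
    using cong_Star.IH
  proof eventually_elim
    case (elim k)
    then show ?case
      using code_less(1,2)[where u=u and v=v] code_less(1,2)[where u=u' and v=v']
      unfolding eq_step_def code_eq_star_code by blast
  qed
  then show ?case by (rule eventually_eq_factI)
next
  case (cong_Div u u' v v')
  have "\<forall>\<^sub>F k in sequentially. eq_step S R (stage S R A k) (code (Div u v)) (code (Div u' v'))"
    using cong_Div.IH
  proof eventually_elim
    case (elim k)
    then show ?case
      using code_less(3,4)[where u=u and v=v] code_less(3,4)[where u=u' and v=v']
      unfolding eq_step_def code_eq_div_code by blast
  qed
  then show ?case by (rule eventually_eq_factI)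
next
  case (idem u)
  then show ?case
    by (intro eventually_eq_factI always_eventually)
      (simp add: eq_step_def code_eq_star_code del: code.simps)
next
  case (star_div u v)
  have "code v < code (Div (Star u v) v)" by (rule code_less)
  then have "eq_step S R d (code (Div (Star u v) v)) (code u)" for d
    using star_div unfolding eq_step_def code_eq_star_code code_eq_div_code
    by (metis word_of_code)
  then show ?case by (intro eventually_eq_factI always_eventually) simp
next
  case (div_star u v)
  have "code v < code (Star (Div u v) v)" by (rule code_less)
  then have "eq_step S R d (code (Star (Div u v) v)) (code u)" for d
    using div_star unfolding eq_step_def code_eq_star_code code_eq_div_code
    by (metis word_of_code)
  then show ?case by (intro eventually_eq_factI always_eventually) simp
next
  case (distrib u v w)
  have "code u < code (Star (Star u v) w)" "code v < code (Star (Star u v) w)"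
    "code w < code (Star (Star u v) w)"
    using code_less(1,2)[where u="Star u v" and v=w] code_less(1,2)[where u=u and v=v] by linarith+
  then have "\<exists>a<code (Star (Star u v) w). \<exists>b<code (Star (Star u v) w). \<exists>c<code (Star (Star u v) w).
      word_of a \<in> words S \<and> word_of b \<in> words S \<and> word_of c \<in> words S \<and>
      code (Star (Star u v) w) = star_code (star_code a b) c \<and>
      code (Star (Star u w) (Star v w)) = star_code (star_code a c) (star_code b c)"
    using distrib word_of_code code_eq_star_code by metis
  then have "eq_step S R d (code (Star (Star u v) w)) (code (Star (Star u w) (Star v w)))" for d
    unfolding eq_step_def by blast
  then show ?case by (intro eventually_eq_factI always_eventually) simp
qed

lemma mem_fact_gen_words:
  assumes "u \<in> gen_words A"
  shows "\<forall>\<^sub>F k in sequentially. mem_fact (code u) \<in> set_decode (stage S R A k)"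
  using assms
proof induction
  case (base a)
  then show ?case by (intro eventually_mem_factI always_eventually) (auto simp: mem_step_def)
next
  case (Star u v)
  have "\<forall>\<^sub>F k in sequentially. mem_step A (stage S R A k) (code (Star u v))"
    using Star.IH
  proof eventually_elim
    case (elim k)
    then show ?case
      using code_less(1,2)[where u=u and v=v] unfolding mem_step_def code_eq_star_code by blast
  qed
  then show ?case by (rule eventually_mem_factI)
next
  case (Div u v)
  have "\<forall>\<^sub>F k in sequentially. mem_step A (stage S R A k) (code (Div u v))"
    using Div.IH
  proof eventually_elim
    case (elim k)
    then show ?case
      using code_less(3,4)[where u=u and v=v] unfolding mem_step_def code_eq_div_code by blast
  qed
  then show ?case by (rule eventually_mem_factI)
qed

lemma ex_stage_iff:
  assumes "A \<subseteq> words S"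
  shows "(\<exists>k. mem_fact (code w) \<in> set_decode (stage S R A k)) \<longleftrightarrow> (\<exists>t\<in>gen_words A. qcong S R w t)"
proof
  assume "\<exists>k. mem_fact (code w) \<in> set_decode (stage S R A k)"
  then show "\<exists>t\<in>gen_words A. qcong S R w t" using stage_sound[OF _ assms] by fastforce
next
  assume "\<exists>t\<in>gen_words A. qcong S R w t"
  then obtain t where t: "t \<in> gen_words A" "qcong S R t w" using qcong.sym by blast
  have "\<forall>\<^sub>F k in sequentially. mem_step A (stage S R A k) (code w)"
    using mem_fact_gen_words[OF t(1), where S = S and R = R] eq_fact_complete[OF t(2), where A = A]
  proof eventually_elim
    case (elim k)
    then show ?case using eq_fact_less unfolding mem_step_def by blast
  qed
  then have "\<forall>\<^sub>F k in sequentially. mem_fact (code w) \<in> set_decode (stage S R A k)"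
    by (rule eventually_mem_factI)
  then show "\<exists>k. mem_fact (code w) \<in> set_decode (stage S R A k)"
    by (auto simp: eventually_sequentially)
qed


section \<open>Finite quandles as certificates of non-membership\<close>

text \<open>Operations on a finite set of numbers, given by tables. The division is found by search, which
  the bound \<open>F \<le> c\<close> makes total; for elements of a quandle the search ends before the bound.\<close>

definition table_op :: "nat \<Rightarrow> nat \<Rightarrow> nat \<Rightarrow> nat" where
  "table_op t a b = apply_table t (prod_encode (a, b))"

definition table_div :: "nat \<Rightarrow> nat \<Rightarrow> nat \<Rightarrow> nat \<Rightarrow> nat" where
  "table_div F t a b = (LEAST c. (c \<in> set_decode F \<and> a = table_op t c b) \<or> F \<le> c)"

lemma computable_table_op:
  "computable t \<Longrightarrow> computable f \<Longrightarrow> computable g \<Longrightarrow> computable (\<lambda>x. table_op (t x) (f x) (g x))"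
  unfolding table_op_def by (intro computable_apply_table computable_basic)

lemma computable_table_div:
  assumes "computable F" "computable t" "computable f" "computable g"
  shows "computable (\<lambda>x. table_div (F x) (t x) (f x) (g x))"
  unfolding table_div_def
  by (intro computable_Least computable_basic decidable_mem computable_table_op
      assms assms[THEN computable_compose]) auto

lemma table_div_eq_qdiv:
  assumes "quandle (set_decode F) (table_op t)" "a \<in> set_decode F" "b \<in> set_decode F"
  shows "table_div F t a b = qdiv (set_decode F) (table_op t) a b"
proof -
  interpret quandle "set_decode F" "table_op t" by fact
  let ?q = "qdiv (set_decode F) (table_op t) a b"
  have q: "?q \<in> set_decode F" "table_op t ?q b = a" using qdiv_in[OF assms(2,3)] by auto
  show ?thesis unfolding table_div_def
  proof (rule Least_equality)
    show "?q \<in> set_decode F \<and> a = table_op t ?q b \<or> F \<le> ?q" using q by simp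
    show "?q \<le> c" if "c \<in> set_decode F \<and> a = table_op t c b \<or> F \<le> c" for c
      using that mem_set_decode_less[OF q(1)] qdiv_unique[OF assms(2,3)] by auto
  qed
qed

text \<open>The quandle axioms with all quantifiers over the finite set, and with unique existence split
  into existence and cancellation.\<close>

definition table_quandle :: "nat \<Rightarrow> nat \<Rightarrow> bool" where
  "table_quandle F t \<longleftrightarrow>
     (\<forall>a\<in>set_decode F. table_op t a a = a \<and> (\<forall>b\<in>set_decode F.
        table_op t a b \<in> set_decode F \<and>
        (\<exists>c\<in>set_decode F. a = table_op t c b) \<and>
        (\<forall>c\<in>set_decode F. table_op t a b = table_op t c b \<longrightarrow> a = c) \<and>
        (\<forall>c\<in>set_decode F. table_op t (table_op t a b) c = table_op t (table_op t a c) (table_op t b c))))"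

lemma table_quandle_iff: "table_quandle F t \<longleftrightarrow> quandle (set_decode F) (table_op t)"
proof
  assume "table_quandle F t"
  then show "quandle (set_decode F) (table_op t)"
    unfolding table_quandle_def by unfold_locales (blast | metis)+
next
  assume "quandle (set_decode F) (table_op t)"
  then interpret quandle "set_decode F" "table_op t" .
  show "table_quandle F t"
    unfolding table_quandle_def
    using idem closed distrib right_div by (metis (no_types, lifting))
qed

lemma decidable_table_quandle:
  assumes "computable F" "computable t"
  shows "decidable (\<lambda>x. table_quandle (F x) (t x))"
  unfolding table_quandle_def
  by (intro computable_basic decidable_ball_mem decidable_bex_mem decidable_mem computable_table_op
      assms assms[THEN computable_compose])

text \<open>A certificate is a quadruple: a finite set, an operation table on it, a table of images of the
  generators, and a subset.\<close>

abbreviation cert_set :: "nat \<Rightarrow> nat" where "cert_set d \<equiv> pfst (pfst d)"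
abbreviation cert_op :: "nat \<Rightarrow> nat" where "cert_op d \<equiv> psnd (pfst d)"
abbreviation cert_gens :: "nat \<Rightarrow> nat" where "cert_gens d \<equiv> pfst (psnd d)"
abbreviation cert_sub :: "nat \<Rightarrow> nat" where "cert_sub d \<equiv> psnd (psnd d)"

definition cert_eval :: "nat \<Rightarrow> qword \<Rightarrow> nat" where
  "cert_eval d = fold_word (apply_table (cert_gens d)) (table_op (cert_op d))
     (table_div (cert_set d) (cert_op d))"

text \<open>A certificate refutes the membership of \<open>w\<close> in the subquandle represented by \<open>gen_words A\<close> if it
  is a finite quandle with an assignment that satisfies the relations, together with a set that is
  closed under the operations and contains the values of \<open>A\<close> but not the value of \<open>w\<close>.\<close>

definition refutes :: "nat set \<Rightarrow> (qword \<times> qword) set \<Rightarrow> qword set \<Rightarrow> nat \<Rightarrow> qword \<Rightarrow> bool" where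
  "refutes S R A d w \<longleftrightarrow>
     table_quandle (cert_set d) (cert_op d) \<and>
     (\<forall>i\<in>S. apply_table (cert_gens d) i \<in> set_decode (cert_set d)) \<and>
     (\<forall>r\<in>R. cert_eval d (fst r) = cert_eval d (snd r)) \<and>
     (\<forall>a\<in>A. cert_eval d a \<in> set_decode (cert_sub d)) \<and>
     (\<forall>a\<in>set_decode (cert_sub d). \<forall>b\<in>set_decode (cert_sub d).
        table_op (cert_op d) a b \<in> set_decode (cert_sub d) \<and>
        table_div (cert_set d) (cert_op d) a b \<in> set_decode (cert_sub d)) \<and>
     cert_eval d w \<notin> set_decode (cert_sub d)"

lemma computable_cert_eval:
  assumes "computable d" "computable f"
  shows "computable (\<lambda>x. cert_eval (d x) (word_of (f x)))"
  unfolding cert_eval_def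
  by (intro computable_fold_word computable_apply_table computable_table_op computable_table_div
      computable_basic assms assms[THEN computable_compose])

lemma decidable_refutes:
  assumes "finite S" "finite R" "finite A" and d: "computable d" "computable f"
  shows "decidable (\<lambda>x. refutes S R A (d x) (word_of (f x)))"
proof -
  have e: "computable (\<lambda>x. cert_eval (d x) u)" for u
    using computable_cert_eval[OF d(1) computable_const, of "code u"] by simp
  show ?thesis
    unfolding refutes_def
    by (intro computable_basic decidable_finite_ball assms(1-3) decidable_table_quandle
        decidable_mem decidable_ball_mem computable_apply_table computable_table_op
        computable_table_div computable_cert_eval e d d[THEN computable_compose])
qed

lemma cert_eval_eq_qeval:
  assumes q: "quandle (set_decode (cert_set d)) (table_op (cert_op d))"
    and g: "\<forall>i\<in>S. apply_table (cert_gens d) i \<in> set_decode (cert_set d)" and u: "u \<in> words S"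
  shows "cert_eval d u =
    qeval (set_decode (cert_set d)) (table_op (cert_op d)) (apply_table (cert_gens d)) u"
  using u
proof (induction u)
  case (Div u v)
  then show ?case
    using table_div_eq_qdiv[OF q] quandle.qeval_in[OF q g] by (simp add: cert_eval_def)
qed (simp_all add: cert_eval_def)

text \<open>An assignment satisfying the relations gives congruent words the same value, and the values
  of \<open>gen_words A\<close> stay in the closed set, which the value of \<open>w\<close> avoids.\<close>

lemma refutes_sound:
  assumes "refutes S R A d w" and R: "R \<subseteq> words S \<times> words S"
    and t: "t \<in> gen_words A" "qcong S R w t"
  shows False
proof -
  let ?ev = "qeval (set_decode (cert_set d)) (table_op (cert_op d)) (apply_table (cert_gens d))"
  have q: "quandle (set_decode (cert_set d)) (table_op (cert_op d))"
    and g: "\<forall>i\<in>S. apply_table (cert_gens d) i \<in> set_decode (cert_set d)"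
    using assms(1) by (auto simp: refutes_def table_quandle_iff)
  have "\<forall>r\<in>R. ?ev (fst r) = ?ev (snd r)"
    using assms(1) R by (auto simp: refutes_def cert_eval_eq_qeval[OF q g] subset_iff mem_Times_iff)
  from quandle.qcong_imp_qeval_eq[OF q g R this t(2)]
  have "cert_eval d w = cert_eval d t"
    by (simp add: cert_eval_eq_qeval[OF q g])
  moreover have "cert_eval d t \<in> set_decode (cert_sub d)"
    using t(1) by induction (use assms(1) in \<open>auto simp: refutes_def cert_eval_def\<close>)
  ultimately show False using assms(1) by (simp add: refutes_def)
qed

text \<open>A homomorphism to a finite quandle that separates \<open>w\<close> from the subquandle becomes a certificate:
  tabulate the operation and the images of the generators, and take the image of the subquandle as
  the closed set.\<close>

lemma refutes_complete:
  fixes F :: "nat set"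
  assumes X: "quandle X op" and g: "\<forall>i\<in>S. g i \<in> X" and S: "finite S"
    and R: "R \<subseteq> words S \<times> words S" "\<forall>r\<in>R. qeval X op g (fst r) = qeval X op g (snd r)"
    and A: "A \<subseteq> words S" and w: "w \<in> words S"
    and F: "finite F" "quandle F op'" "quandle_hom X op F op' \<phi>"
    and sep: "\<phi> (qeval X op g w) \<notin> \<phi> ` qeval X op g ` gen_words A"
  shows "\<exists>d. refutes S R A d w"
proof -
  let ?Z = "\<phi> ` qeval X op g ` gen_words A"
  have "finite (prod_encode ` (F \<times> F))" using F(1) by simp
  then obtain t where t0: "\<And>n. n \<in> prod_encode ` (F \<times> F) \<Longrightarrow> apply_table t n = op' (pfst n) (psnd n)"
    using ex_table[where f = "\<lambda>n. op' (pfst n) (psnd n)"] by blast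
  have t: "table_op t a b = op' a b" if "a \<in> F" "b \<in> F" for a b
    using t0[of "prod_encode (a, b)"] that by (simp add: table_op_def)
  obtain e where e: "\<And>i. i \<in> S \<Longrightarrow> apply_table e i = \<phi> (g i)"
    using ex_table[OF S, of "\<lambda>i. \<phi> (g i)"] by blast
  have in_X: "qeval X op g u \<in> X" if "u \<in> words S" for u
    using quandle.qeval_in[OF X g that] .
  have Z: "?Z \<subseteq> F"
    using F(3) in_X gen_words_subset[OF A] by (auto simp: quandle_hom_def)
  define d where "d = prod_encode (prod_encode (set_encode F, t), prod_encode (e, set_encode ?Z))"
  have [simp]: "set_decode (cert_set d) = F" "cert_op d = t" "cert_gens d = e"
    "set_decode (cert_sub d) = ?Z"
    using F(1) finite_subset[OF Z F(1)] by (simp_all add: d_def set_encode_inverse)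
  have qt: "quandle F (table_op t)"
  proof -
    interpret F: quandle F op' by (rule F(2))
    show ?thesis
    proof
      fix a b assume ab: "a \<in> F" "b \<in> F"
      have "(c \<in> F \<and> a = op' c b) \<longleftrightarrow> (c \<in> F \<and> a = table_op t c b)" for c
        using ab by (auto simp: t)
      then show "\<exists>!c. c \<in> F \<and> a = table_op t c b" using F.right_div[OF ab] by simp
    next
      fix a b c assume abc: "a \<in> F" "b \<in> F" "c \<in> F"
      then show "table_op t (table_op t a b) c = table_op t (table_op t a c) (table_op t b c)"
        using F.distrib[OF abc] by (simp add: t F.closed)
    qed (simp_all add: t F.closed F.idem)
  qed
  have hom: "quandle_hom X op F (table_op t) \<phi>"
    using F(3) by (simp add: quandle_hom_def t)
  have ge: "\<forall>i\<in>S. apply_table e i \<in> F"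
    using F(3) g by (simp add: e quandle_hom_def)
  have ev: "cert_eval d u = \<phi> (qeval X op g u)" if u: "u \<in> words S" for u
  proof -
    have "cert_eval d u = qeval F (table_op t) (apply_table e) u"
      using cert_eval_eq_qeval[of d S u] qt ge u by simp
    also have "\<dots> = qeval F (table_op t) (\<lambda>i. \<phi> (g i)) u"
      using u by (induction u) (simp_all add: e)
    also have "\<dots> = \<phi> (qeval X op g u)"
      by (rule quandle_hom_qeval[OF X qt hom g u])
    finally show ?thesis .
  qed
  \<comment> \<open>Closure of the image then follows from the closure of \<open>gen_words A\<close> under both operations.\<close>
  have Z_words: "?Z = cert_eval d ` gen_words A"
    unfolding image_image using ev gen_words_subset[OF A] by (intro image_cong) auto
  have "refutes S R A d w"
    unfolding refutes_def
  proof (intro conjI)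
    show "table_quandle (cert_set d) (cert_op d)"
      using qt by (simp add: table_quandle_iff)
    show "\<forall>i\<in>S. apply_table (cert_gens d) i \<in> set_decode (cert_set d)" using ge by simp
    show "\<forall>r\<in>R. cert_eval d (fst r) = cert_eval d (snd r)"
      using R by (auto simp: ev subset_iff mem_Times_iff)
    show "\<forall>a\<in>A. cert_eval d a \<in> set_decode (cert_sub d)"
      by (auto simp: Z_words intro: gen_words.base)
    show "cert_eval d w \<notin> set_decode (cert_sub d)" using sep w by (simp add: ev)
    have "table_op t (cert_eval d u) (cert_eval d v) = cert_eval d (Star u v)"
      "table_div (cert_set d) t (cert_eval d u) (cert_eval d v) = cert_eval d (Div u v)" for u v
      by (simp_all add: cert_eval_def)
    then show "\<forall>a\<in>set_decode (cert_sub d). \<forall>b\<in>set_decode (cert_sub d).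
        table_op (cert_op d) a b \<in> set_decode (cert_sub d) \<and>
        table_div (cert_set d) (cert_op d) a b \<in> set_decode (cert_sub d)"
      by (simp add: Z_words gen_words.Star gen_words.Div)
  qed
  then show ?thesis by blast
qed


section \<open>The decision procedure\<close>

text \<open>Two complementary semidecidable properties are decidable: search for a witness of either, and
  see which one was found. Numbers that do not code a word of \<open>W\<close> stop the search at once, so that it
  succeeds for every input and the minimisation is regular.\<close>

lemma algorithm_decides_race:
  assumes W: "decidable (\<lambda>n. word_of n \<in> W)"
    and P: "decidable (\<lambda>z. P (pfst z) (word_of (psnd z)))"
    and Q: "decidable (\<lambda>z. Q (pfst z) (word_of (psnd z)))"
    and excl: "\<And>w. w \<in> W \<Longrightarrow> (\<exists>k. P k w) \<noteq> (\<exists>k. Q k w)"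
  shows "algorithm_decides W (\<lambda>w. \<exists>k. P k w)"
proof -
  define K where "K n = (LEAST k. word_of n \<notin> W \<or> P k (word_of n) \<or> Q k (word_of n))" for n
  have "computable K"
    unfolding K_def[abs_def]
    using excl by (intro computable_Least computable_basic P Q decidable_compose[OF W]) blast
  then have "decidable (\<lambda>n. P (K n) (word_of n))"
    using decidable_compose[OF P, of "\<lambda>n. prod_encode (K n, n)"]
    by (simp add: computable_pair computable_id)
  then obtain f where f: "recursive 1 f" "\<And>n. f [n] = of_bool (P (K n) (word_of n))"
    unfolding decidable_def computable_def recursive_on_def by force
  have "P (K (code w)) w \<longleftrightarrow> (\<exists>k. P k w)" if "w \<in> W" for w
  proof -
    have "\<exists>k. P k w \<or> Q k w" using excl[OF that] by blast
    then have "P (K (code w)) w \<or> Q (K (code w)) w"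
      using LeastI_ex[of "\<lambda>k. word_of (code w) \<notin> W \<or> P k w \<or> Q k w"] that unfolding K_def by auto
    then show ?thesis using excl[OF that] by blast
  qed
  then show ?thesis
    using f unfolding algorithm_decides_def by (intro exI[of _ f]) simp
qed

theorem proposition3p5:
  fixes X :: "'a set" and op :: "'a \<Rightarrow> 'a \<Rightarrow> 'a"
  assumes "quandle X op"
    and "finitely_presented X op"
    and "subquandle_separable X op"
  shows "solvable_generalised_word_problem X op"
  unfolding solvable_generalised_word_problem_def
proof (intro allI impI, elim conjE)
  fix S R g Y
  assume pres: "finite_presentation X op S R g" and Y: "fin_gen_subquandle X op Y"
  have fin: "finite S" "finite R" and R: "R \<subseteq> words S \<times> words S" and g: "\<forall>i\<in>S. g i \<in> X"
    and surj: "qeval X op g ` words S = X"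
    and cong: "\<And>u v. u \<in> words S \<Longrightarrow> v \<in> words S \<Longrightarrow>
      qeval X op g u = qeval X op g v \<longleftrightarrow> qcong S R u v"
    using pres unfolding finite_presentation_def by auto
  obtain A where A: "finite A" "A \<subseteq> words S" and Y_eq: "Y = qeval X op g ` gen_words A"
    using fin_gen_subquandle_words[OF surj Y] .
  let ?P = "\<lambda>k w. mem_fact (code w) \<in> set_decode (stage S R A k)"
  have P: "(\<exists>k. ?P k w) \<longleftrightarrow> qeval X op g w \<in> Y" if "w \<in> words S" for w
    unfolding ex_stage_iff[OF A(2)] Y_eq
    using cong[OF that] gen_words_subset[OF A(2)] by blast
  have Q: "(\<exists>d. refutes S R A d w) \<longleftrightarrow> qeval X op g w \<notin> Y" if w: "w \<in> words S" for w
  proof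
    assume "\<exists>d. refutes S R A d w"
    then show "qeval X op g w \<notin> Y"
      using refutes_sound[OF _ R] P[OF w] unfolding ex_stage_iff[OF A(2)] by blast
  next
    assume "qeval X op g w \<notin> Y"
    then have "qeval X op g w \<in> X - Y" using surj w by blast
    moreover have "separable X op Y"
      using assms(3) Y unfolding subquandle_separable_def by blast
    ultimately obtain F :: "nat set" and op' \<phi> where
      F: "finite F" "quandle F op'" "quandle_hom X op F op' \<phi>" "\<phi> (qeval X op g w) \<notin> \<phi> ` Y"
      unfolding separable_def by blast
    have "\<forall>r\<in>R. qeval X op g (fst r) = qeval X op g (snd r)"
    proof
      fix r assume "r \<in> R"
      then show "qeval X op g (fst r) = qeval X op g (snd r)"
        using R by (subst cong) (auto intro: qcong.rel)
    qed
    from refutes_complete[OF assms(1) g fin(1) R this A(2) w F(1-3) F(4)[unfolded Y_eq]]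
    show "\<exists>d. refutes S R A d w" .
  qed
  have "algorithm_decides (words S) (\<lambda>w. \<exists>k. ?P k w)"
  proof (rule algorithm_decides_race)
    show "decidable (\<lambda>n. word_of n \<in> words S)"
      by (intro decidable_words fin computable_id)
    show "decidable (\<lambda>z. mem_fact (code (word_of (psnd z))) \<in> set_decode (stage S R A (pfst z)))"
      unfolding code_word_of
      by (intro decidable_mem computable_basic computable_compose[OF computable_stage] fin A(1))
    show "decidable (\<lambda>z. refutes S R A (pfst z) (word_of (psnd z)))"
      by (intro decidable_refutes computable_basic fin A(1))
    show "(\<exists>k. ?P k w) \<noteq> (\<exists>d. refutes S R A d w)" if "w \<in> words S" for w
      using P[OF that] Q[OF that] by blast
  qed
  then show "algorithm_decides (words S) (\<lambda>w. qeval X op g w \<in> Y)"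
    using P unfolding algorithm_decides_def by simp
qed

end
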